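(* Let $(a,b)$ be a maximal gap of the Lagrange spectrum $\mathbb{L}$ (so $a$ is its left endpoint), and let $\alpha$ be an irrational number with $\mu(\alpha)=a$. Let $B=(\ldots,b_{-1},b_0,b_1,\ldots)$ be a doubly infinite sequence of positive integers strongly associated with $\alpha$. Then $B$ is eventually periodic, i.e. there exist finite sequences $P_l,R,P_r$ of positive integers (with $P_l,P_r$ nonempty) such that $B=(\ldots,P_l,P_l,P_l,R,P_r,P_r,P_r,\ldots)$.
   Context: For irrational $\alpha=[a_0;a_1,a_2,\ldots]$, the Lagrange constant is $\mu(\alpha)=\bigl(\liminf_{p\in\mathbb{Z},q\in\mathbb{N}}|q(q\alpha-p)|\bigr)^{-1}$; equivalently $\mu(\alpha)=\limsup_{i\to\infty}\lambda_i(\alpha)$ where $\lambda_i(\alpha)=[a_i;a_{i+1},a_{i+2},\ldots]+[0;a_{i-1},a_{i-2},\ldots,a_1]$. The Lagrange spectrum $\mathbb{L}$ is the set of values $\mu(\alpha)$ over irrational $\alpha$. A maximal gap of $\mathbb{L}$ is an open interval $(a,b)$ with $(a,b)\cap\mathbb{L}=\emptyset$ and $a,b\in\mathbb{L}$. For a doubly infinite sequence $B=(\ldots,b_{-1},b_0,b_1,\ldots)$ of positive integers and integer $i$, $\lambda_i(B)=[b_i;b_{i-1},b_{i-2},\ldots]+[0;b_{i+1},b_{i+2},\ldots]$, and $M(B)=\sup_i\lambda_i(B)$. $B$ is weakly associated with $\alpha=[a_0;a_1,a_2,\ldots]$ if for every natural $i$ the block $(b_{-i},\ldots,b_0,\ldots,b_i)$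 occurs infinitely many times as a consecutive block in $(a_1,a_2,\ldots)$; $B$ is strongly associated with $\alpha$ if in addition $\mu(\alpha)=\lambda_0(B)=M(B)$. *)

theory Defs
  imports Complex_Main "HOL-Library.Extended_Real" "HOL-Library.Liminf_Limsup"
begin

text \<open>The finite continued fraction \<open>[c 0; c 1, \<dots>, c n]\<close>.\<close>

primrec cf_convergent :: "nat \<Rightarrow> (nat \<Rightarrow> int) \<Rightarrow> real" where
  "cf_convergent 0 c = of_int (c 0)"
| "cf_convergent (Suc n) c = of_int (c 0) + 1 / cf_convergent n (\<lambda>k. c (Suc k))"

text \<open>The infinite continued fraction \<open>[c 0; c 1, c 2, \<dots>]\<close>. The limit exists whenever
  \<open>c k\<close> is positive for all \<open>k \<ge> 1\<close>.\<close>

definition cfrac :: "(nat \<Rightarrow> int) \<Rightarrow> real" where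
  "cfrac c = lim (\<lambda>n. cf_convergent n c)"

primrec complete_quotient :: "real \<Rightarrow> nat \<Rightarrow> real" where
  "complete_quotient \<alpha> 0 = \<alpha>"
| "complete_quotient \<alpha> (Suc n) = 1 / frac (complete_quotient \<alpha> n)"

text \<open>For irrational \<open>\<alpha>\<close> these are the \<open>a\<^sub>n\<close> in \<open>\<alpha> = [a\<^sub>0; a\<^sub>1, a\<^sub>2, \<dots>]\<close>.\<close>

definition partial_quotient :: "real \<Rightarrow> nat \<Rightarrow> int" where
  "partial_quotient \<alpha> n = \<lfloor>complete_quotient \<alpha> n\<rfloor>"

text \<open>The lower limit is taken over all pairs \<open>(p, q)\<close> with \<open>q \<ge> 1\<close>, along the cofinite filter.
  The inverse is that of the extended reals, so the value is \<open>\<infinity>\<close> if the lower limit is \<open>0\<close>.\<close>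

definition lagrange_constant :: "real \<Rightarrow> ereal" where
  "lagrange_constant \<alpha> =
     inverse (Liminf (inf cofinite (principal {(p :: int, q :: nat). q \<ge> 1}))
       (\<lambda>(p, q). ereal \<bar>of_nat q * (of_nat q * \<alpha> - of_int p)\<bar>))"

definition lagrange_spectrum :: "real set" where
  "lagrange_spectrum = {x. \<exists>\<alpha>. \<alpha> \<notin> \<rat> \<and> lagrange_constant \<alpha> = ereal x}"

definition maximal_gap :: "real \<Rightarrow> real \<Rightarrow> bool" where
  "maximal_gap a b \<longleftrightarrow> a < b \<and> {a<..<b} \<inter> lagrange_spectrum = {} \<and>
     a \<in> lagrange_spectrum \<and> b \<in> lagrange_spectrum"

definition biinf_lambda :: "(int \<Rightarrow> int) \<Rightarrow> int \<Rightarrow> real" where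
  "biinf_lambda B i =
     cfrac (\<lambda>k. B (i - int k)) + cfrac (\<lambda>k. if k = 0 then 0 else B (i + int k))"

definition biinf_sup :: "(int \<Rightarrow> int) \<Rightarrow> ereal" where
  "biinf_sup B = (SUP i. ereal (biinf_lambda B i))"

text \<open>The index \<open>k\<close> is the position in \<open>(a\<^sub>1, a\<^sub>2, \<dots>)\<close> at which an occurrence of the block
  \<open>(B (-i), \<dots>, B i)\<close> starts.\<close>

definition weakly_associated :: "(int \<Rightarrow> int) \<Rightarrow> real \<Rightarrow> bool" where
  "weakly_associated B \<alpha> \<longleftrightarrow>
     (\<forall>i :: nat. infinite {k. k \<ge> 1 \<and>
        (\<forall>j \<le> 2 * i. partial_quotient \<alpha> (k + j) = B (int j - int i))})"

definition strongly_associated :: "(int \<Rightarrow> int) \<Rightarrow> real \<Rightarrow> bool" where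
  "strongly_associated B \<alpha> \<longleftrightarrow> weakly_associated B \<alpha> \<and>
     lagrange_constant \<alpha> = ereal (biinf_lambda B 0) \<and>
     ereal (biinf_lambda B 0) = biinf_sup B"

text \<open>\<open>B = (\<dots>, Pl, Pl, Pl, R, Pr, Pr, Pr, \<dots>)\<close>, where the block \<open>R\<close> (possibly empty)
  starts at some position \<open>m\<close>.\<close>

definition biinf_decomposition :: "(int \<Rightarrow> int) \<Rightarrow> int list \<Rightarrow> int list \<Rightarrow> int list \<Rightarrow> bool" where
  "biinf_decomposition B Pl R Pr \<longleftrightarrow> (\<exists>m :: int.
     (\<forall>k :: nat. B (m - 1 - int k) = rev Pl ! (k mod length Pl)) \<and>
     (\<forall>k < length R. B (m + int k) = R ! k) \<and>
     (\<forall>k :: nat. B (m + int (length R) + int k) = Pr ! (k mod length Pr)))"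

end

theory Submission
  imports Defs
begin

text \<open>Let \<open>F\<close> be the finite set of blocks of a large length \<open>l\<close> that occur infinitely often in the
  expansion of \<open>\<alpha>\<close>. A periodic sequence all of whose blocks lie in \<open>F\<close> has Lagrange constant
  less than \<open>b\<close>, hence at most \<open>a\<close> because of the gap; in particular its \<open>\<lambda>\<^sub>0\<close> does not exceed
  \<open>\<lambda>\<^sub>0(B) = a\<close>. Since any two blocks of \<open>F\<close> are joined by a piece of the expansion of \<open>\<alpha>\<close>,
  whenever the block of \<open>l - 1\<close> letters of \<open>B\<close> preceding a position \<open>m\<close> can be continued within \<open>F\<close>
  by another letter, there is such a periodic sequence that follows \<open>B\<close> from far to the left up to
  \<open>m - 1\<close> and then branches off. So the letter of \<open>B\<close> at \<open>m\<close> must be the extreme admissible one,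
  the largest or the smallest according to the parity of \<open>m\<close>. It is therefore determined by
  finitely many data (the parity and the preceding block), and \<open>B\<close> is eventually periodic to
  the right. The situation is symmetric under reversal.\<close>

section \<open>Comparing continued fractions\<close>

text \<open>Two steps of the recursion divide the difference by
  \<open>(d * x 2 + 1) * (d * y 2 + 1) \<ge> 4\<close>, while one step need not contract near 1.
  Since only the recursion is assumed, the bound applies to convergents, infinite continued
  fractions and quotients of denominators.\<close>

lemma chain_close:
  fixes x y :: "nat \<Rightarrow> real" and c :: "nat \<Rightarrow> int"
  assumes "\<And>k. k \<le> 2 * n \<Longrightarrow> x k = of_int (c k) + 1 / x (Suc k)"
    and "\<And>k. k \<le> 2 * n \<Longrightarrow> y k = of_int (c k) + 1 / y (Suc k)"
    and "\<And>k. 1 \<le> k \<Longrightarrow> k \<le> 2 * n \<Longrightarrow> c k \<ge> 1"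
    and "\<And>k. 1 \<le> k \<Longrightarrow> k \<le> Suc (2 * n) \<Longrightarrow> x k \<ge> 1"
    and "\<And>k. 1 \<le> k \<Longrightarrow> k \<le> Suc (2 * n) \<Longrightarrow> y k \<ge> 1"
  shows "\<bar>x 0 - y 0\<bar> \<le> (1 / 4) ^ n"
  using assms
proof (induction n arbitrary: x y c)
  case 0
  have "x 1 \<ge> 1" "y 1 \<ge> 1" using 0 by simp_all
  then have "0 < 1 / x 1" "1 / x 1 \<le> 1" "0 < 1 / y 1" "1 / y 1 \<le> 1" by simp_all
  moreover have "x 0 - y 0 = 1 / x 1 - 1 / y 1" using 0(1)[of 0] 0(2)[of 0] by simp
  ultimately show ?case unfolding abs_le_iff power_0 by linarith
next
  case (Suc n)
  have IH: "\<bar>x 2 - y 2\<bar> \<le> (1 / 4) ^ n"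
    using Suc.IH[of "\<lambda>k. x (k + 2)" "\<lambda>k. c (k + 2)" "\<lambda>k. y (k + 2)"]
      Suc.prems(1)[of "_ + 2"] Suc.prems(2)[of "_ + 2"] Suc.prems(3)[of "_ + 2"]
      Suc.prems(4)[of "_ + 2"] Suc.prems(5)[of "_ + 2"]
    by (simp add: numeral_2_eq_2)
  define d where "d = real_of_int (c 1)"
  have d: "d \<ge> 1" using Suc.prems(3)[of 1] by (simp add: d_def)
  have x2: "x 2 \<ge> 1" and y2: "y 2 \<ge> 1"
    using Suc.prems(4)[of 2] Suc.prems(5)[of 2] by simp_all
  have x0: "x 0 = of_int (c 0) + 1 / (d + 1 / x 2)"
    using Suc.prems(1)[of 0] Suc.prems(1)[of 1] by (simp add: d_def numeral_2_eq_2)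
  have y0: "y 0 = of_int (c 0) + 1 / (d + 1 / y 2)"
    using Suc.prems(2)[of 0] Suc.prems(2)[of 1] by (simp add: d_def numeral_2_eq_2)
  have dx: "d * x 2 + 1 \<ge> 2" and dy: "d * y 2 + 1 \<ge> 2"
    using mult_mono[of 1 d 1 "x 2"] mult_mono[of 1 d 1 "y 2"] d x2 y2 by simp_all
  have "1 / (d + 1 / x 2) = x 2 / (d * x 2 + 1)" "1 / (d + 1 / y 2) = y 2 / (d * y 2 + 1)"
    using x2 y2 by (simp_all add: field_simps)
  then have "x 0 - y 0 = x 2 / (d * x 2 + 1) - y 2 / (d * y 2 + 1)"
    using x0 y0 by simp
  also have "\<dots> = (x 2 - y 2) / ((d * x 2 + 1) * (d * y 2 + 1))"
    using dx dy by (simp add: diff_frac_eq algebra_simps)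
  finally have "\<bar>x 0 - y 0\<bar> = \<bar>x 2 - y 2\<bar> / ((d * x 2 + 1) * (d * y 2 + 1))"
    using dx dy by (simp add: abs_mult)
  also have "\<dots> \<le> \<bar>x 2 - y 2\<bar> / 4"
    using mult_mono[OF dx dy] dx dy by (intro divide_left_mono) auto
  also have "\<dots> \<le> (1 / 4) ^ Suc n" using IH by simp
  finally show ?case .
qed

text \<open>At the first differing letter, \<open>1 / x 1 \<le> 1\<close> and
  \<open>1 / y 1 \<ge> 1 / A\<close> leave a distance of at least \<open>1 / A\<close>. Every step
  back reverses the order and divides the distance by at most \<open>A * A\<close>.\<close>

lemma chain_separate:
  fixes x y :: "nat \<Rightarrow> real" and c d :: "nat \<Rightarrow> int"
  assumes "\<And>k. k \<le> n \<Longrightarrow> x k = of_int (c k) + 1 / x (Suc k)"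
    and "\<And>k. k \<le> n \<Longrightarrow> y k = of_int (d k) + 1 / y (Suc k)"
    and "\<And>k. k < n \<Longrightarrow> c k = d k" and "c n < d n"
    and "\<And>k. k \<le> Suc n \<Longrightarrow> 1 \<le> x k \<and> x k \<le> A"
    and "\<And>k. k \<le> Suc n \<Longrightarrow> 1 \<le> y k \<and> y k \<le> A"
  shows "(1 / A) ^ Suc (2 * n) \<le> (- 1) ^ n * (y 0 - x 0)"
  using assms
proof (induction n arbitrary: x y c d)
  case 0
  have "1 \<le> x 1" "1 \<le> y 1" "y 1 \<le> A" using 0(5)[of 1] 0(6)[of 1] by simp_all
  then have "1 / x 1 \<le> 1" "1 / A \<le> 1 / y 1" by (simp_all add: frac_le)
  moreover have "y 0 - x 0 = of_int (d 0 - c 0) + (1 / y 1 - 1 / x 1)"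
    using 0(1)[of 0] 0(2)[of 0] by simp
  moreover have "real_of_int (d 0 - c 0) \<ge> 1" using 0(4) by linarith
  ultimately show ?case by simp
next
  case (Suc n)
  have IH: "(1 / A) ^ Suc (2 * n) \<le> (- 1) ^ n * (y 1 - x 1)"
    using Suc.IH[of "\<lambda>k. x (Suc k)" "\<lambda>k. c (Suc k)" "\<lambda>k. y (Suc k)" "\<lambda>k. d (Suc k)"] Suc.prems
    by simp
  have b: "1 \<le> x 1" "x 1 \<le> A" "1 \<le> y 1" "y 1 \<le> A"
    using Suc.prems(5)[of 1] Suc.prems(6)[of 1] by simp_all
  have "(1 / A) ^ Suc (2 * Suc n) = (1 / A) ^ Suc (2 * n) / (A * A)"
    using b by (simp add: power_divide)
  also have "\<dots> \<le> (- 1) ^ n * (y 1 - x 1) / (A * A)"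
    using IH b by (intro divide_right_mono) auto
  also have "\<dots> \<le> (- 1) ^ n * (y 1 - x 1) / (x 1 * y 1)"
  proof (rule divide_left_mono)
    show "x 1 * y 1 \<le> A * A" using b by (intro mult_mono) auto
    have "0 \<le> (1 / A) ^ Suc (2 * n)" using b by simp
    then show "0 \<le> (- 1) ^ n * (y 1 - x 1)" using IH by linarith
  qed (use b in auto)
  also have "\<dots> = (- 1) ^ Suc n * (1 / y 1 - 1 / x 1)"
    using b by (simp add: field_simps)
  also have "1 / y 1 - 1 / x 1 = y 0 - x 0"
    using Suc.prems(1)[of 0] Suc.prems(2)[of 0] Suc.prems(3)[of 0] by simp
  finally show ?case .
qed

section \<open>Infinite continued fractions as limits of convergents\<close>

lemma cf_convergent_ge:
  assumes "\<forall>k\<ge>1. c k \<ge> 1"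
  shows "cf_convergent n c \<ge> of_int (c 0)"
  using assms
proof (induction n arbitrary: c)
  case (Suc n)
  have "cf_convergent n (\<lambda>k. c (Suc k)) \<ge> of_int (c 1)"
    using Suc.IH[of "\<lambda>k. c (Suc k)"] Suc.prems by simp
  moreover have "real_of_int (c 1) \<ge> 1" using Suc.prems by simp
  ultimately have "cf_convergent n (\<lambda>k. c (Suc k)) > 0" by linarith
  then show ?case by simp
qed simp

lemma cf_convergent_close:
  assumes c: "\<forall>k\<ge>1. c k \<ge> 1" and "2 * n < m" "2 * n < m'"
  shows "\<bar>cf_convergent m c - cf_convergent m' c\<bar> \<le> (1 / 4) ^ n"
proof -
  \<comment> \<open>\<open>x m k\<close> is the tail of the \<open>m\<close>-th convergent from
    letter \<open>k\<close> on; its recursion is used for \<open>k < m\<close>, which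
    \<open>2 * n < m\<close> secures.\<close>
  define x where "x = (\<lambda>m k. cf_convergent (m - k) (\<lambda>j. c (k + j)))"
  have step: "x m k = of_int (c k) + 1 / x m (Suc k)" if "k < m" for m k
  proof -
    have "m - k = Suc (m - Suc k)" using that by simp
    then show ?thesis by (simp add: x_def del: diff_Suc_Suc)
  qed
  have ge: "x m k \<ge> 1" if "k \<ge> 1" for m k
  proof -
    have "real_of_int (c k) \<ge> 1" using c that by simp
    with cf_convergent_ge[of "\<lambda>j. c (k + j)" "m - k"] c show ?thesis by (simp add: x_def)
  qed
  have "\<bar>x m 0 - x m' 0\<bar> \<le> (1 / 4) ^ n"
    using assms by (intro chain_close[where c = c] step ge) auto
  then show ?thesis by (simp add: x_def)
qed

lemma cf_convergent_LIMSEQ: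
  assumes c: "\<forall>k\<ge>1. c k \<ge> 1"
  shows "(\<lambda>n. cf_convergent n c) \<longlonglongrightarrow> cfrac c"
proof -
  have "Cauchy (\<lambda>n. cf_convergent n c)"
  proof (rule metric_CauchyI)
    fix e :: real assume "e > 0"
    then obtain n where n: "(1 / 4) ^ n < e"
      using real_arch_pow_inv[of e "1 / 4"] by auto
    show "\<exists>M. \<forall>m\<ge>M. \<forall>n\<ge>M. dist (cf_convergent m c) (cf_convergent n c) < e"
    proof (intro exI[of _ "Suc (2 * n)"] allI impI)
      fix m m' assume "m \<ge> Suc (2 * n)" "m' \<ge> Suc (2 * n)"
      then show "dist (cf_convergent m c) (cf_convergent m' c) < e"
        using cf_convergent_close[OF c, where n = n and m = m and m' = m'] n
        by (simp add: dist_real_def)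
    qed
  qed
  then show ?thesis
    unfolding cfrac_def by (simp add: Cauchy_convergent_iff convergent_LIMSEQ_iff)
qed

lemma cfrac_ge:
  assumes c: "\<forall>k\<ge>1. c k \<ge> 1"
  shows "cfrac c \<ge> of_int (c 0)"
  using cf_convergent_LIMSEQ[OF c] cf_convergent_ge[OF c]
  by (intro LIMSEQ_le_const) auto

lemma cfrac_unfold:
  assumes c: "\<forall>k\<ge>1. c k \<ge> 1"
  shows "cfrac c = of_int (c 0) + 1 / cfrac (\<lambda>k. c (Suc k))"
proof (rule LIMSEQ_unique)
  show "(\<lambda>n. cf_convergent (Suc n) c) \<longlonglongrightarrow> cfrac c"
    using cf_convergent_LIMSEQ[OF c] by (rule LIMSEQ_Suc)
  have "real_of_int (c 1) \<ge> 1" using c by simp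
  then have "cfrac (\<lambda>k. c (Suc k)) \<noteq> 0"
    using cfrac_ge[of "\<lambda>k. c (Suc k)"] c by fastforce
  moreover have "(\<lambda>n. cf_convergent n (\<lambda>k. c (Suc k))) \<longlonglongrightarrow> cfrac (\<lambda>k. c (Suc k))"
    using c by (intro cf_convergent_LIMSEQ) auto
  ultimately show "(\<lambda>n. cf_convergent (Suc n) c) \<longlonglongrightarrow> of_int (c 0) + 1 / cfrac (\<lambda>k. c (Suc k))"
    by (auto intro!: tendsto_intros)
qed

lemma cfrac_bounds:
  assumes c: "\<forall>k. c k \<ge> 1"
  shows "of_int (c 0) < cfrac c" "cfrac c \<le> of_int (c 0) + 1"
proof -
  have "real_of_int (c 1) \<ge> 1" using c by simp
  then have "cfrac (\<lambda>k. c (Suc k)) \<ge> 1"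
    using cfrac_ge[of "\<lambda>k. c (Suc k)"] c by fastforce
  then show "of_int (c 0) < cfrac c" "cfrac c \<le> of_int (c 0) + 1"
    using cfrac_unfold[of c] c by auto
qed

section \<open>Convergents and the Lagrange constant\<close>

lemma abs_of_int_ge_1: "k \<noteq> 0 \<Longrightarrow> 1 \<le> \<bar>real_of_int k\<bar>"
  by linarith

text \<open>Abstract complete quotients, shared by the expansion of an irrational number and by the
  right tails of a two-sided sequence.\<close>

locale cf_expansion =
  fixes a :: "nat \<Rightarrow> int" and x :: "nat \<Rightarrow> real"
  assumes unfold: "x n = of_int (a n) + 1 / x (Suc n)"
    and gt_1: "x (Suc n) > 1"
begin

fun num :: "nat \<Rightarrow> int" where
  "num 0 = 1"
| "num (Suc 0) = a 0"
| "num (Suc (Suc n)) = a (Suc n) * num (Suc n) + num n"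

fun den :: "nat \<Rightarrow> int" where
  "den 0 = 0"
| "den (Suc 0) = 1"
| "den (Suc (Suc n)) = a (Suc n) * den (Suc n) + den n"

declare num.simps(3) [simp del] den.simps(3) [simp del]

text \<open>Indices are shifted by one: \<open>num (Suc n) / den (Suc n)\<close> is the \<open>n\<close>-th convergent, and
  \<open>lam n\<close> is the paper's \<open>\<lambda>\<^sub>n\<^sub>+\<^sub>1\<close>.\<close>

definition err :: "nat \<Rightarrow> real" where
  "err n = of_int (den n) * x 0 - of_int (num n)"

definition lam :: "nat \<Rightarrow> real" where
  "lam n = x (Suc n) + of_int (den n) / of_int (den (Suc n))"

lemma a_ge_1: "a (Suc n) \<ge> 1"
proof -
  have "1 / x (Suc (Suc n)) < 1" using gt_1[of "Suc n"] by simp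
  then have "real_of_int (a (Suc n)) > 0" using unfold[of "Suc n"] gt_1[of n] by linarith
  then show ?thesis by simp
qed

lemma den_nonneg: "den n \<ge> 0"
proof (induction n rule: den.induct)
  case (3 n)
  then show ?case using a_ge_1[of n] by (simp add: den.simps(3))
qed simp_all

lemma den_Suc_Suc_ge: "den (Suc (Suc n)) \<ge> den (Suc n) + den n"
  using mult_right_mono[OF a_ge_1[of n] den_nonneg[of "Suc n"]] by (simp add: den.simps(3))

lemma den_Suc_ge_1: "den (Suc n) \<ge> 1"
proof (induction n)
  case (Suc n)
  then show ?case using den_Suc_Suc_ge[of n] den_nonneg[of n] by linarith
qed simp

lemma den_mono: "m \<le> n \<Longrightarrow> den m \<le> den n"
proof (rule lift_Suc_mono_le[of den])
  show "den n \<le> den (Suc n)" for n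
    using den_Suc_Suc_ge[of "n - 1"] den_nonneg[of "n - 1"] by (cases n) auto
qed

lemma den_ge: "den (Suc n) \<ge> int n"
proof (induction n)
  case (Suc n)
  show ?case
  proof (cases n)
    case 0
    then show ?thesis using den_Suc_ge_1[of 1] by simp
  next
    case (Suc k)
    then show ?thesis using Suc.IH den_Suc_Suc_ge[of n] den_Suc_ge_1[of k] by simp
  qed
qed simp

text \<open>The errors obey the recurrence of \<open>num\<close> and \<open>den\<close>, and
  \<open>x (Suc n) - a (Suc n)\<close> is \<open>1 / x (Suc (Suc n))\<close>. Hence consecutive
  errors alternate in sign and decrease in absolute value.\<close>

lemma err_Suc: "err n = - x (Suc n) * err (Suc n)"
proof (induction n)
  case 0
  have "x 1 * (x 0 - of_int (a 0)) = 1" using unfold[of 0] gt_1[of 0] by simp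
  then show ?case by (simp add: err_def)
next
  case (Suc n)
  have "err (Suc (Suc n)) = of_int (a (Suc n)) * err (Suc n) + err n"
    by (simp add: err_def num.simps(3) den.simps(3) algebra_simps)
  also have "\<dots> = (of_int (a (Suc n)) - x (Suc n)) * err (Suc n)"
    by (subst Suc) (simp add: algebra_simps)
  also have "\<dots> = - (1 / x (Suc (Suc n))) * err (Suc n)"
    using unfold[of "Suc n"] by simp
  finally show ?case using gt_1[of "Suc n"] by (simp add: field_simps)
qed

lemma det: "num (Suc n) * den n - num n * den (Suc n) = (- 1) ^ Suc n"
  by (induction n) (simp_all add: num.simps(3) den.simps(3) algebra_simps)

text \<open>Eliminating \<open>err n\<close> from the determinant identity by \<open>err_Suc\<close>
  leaves \<open>err (Suc n)\<close> times \<open>den (Suc n) * lam n\<close>, up to sign. This ties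
  \<open>lam\<close> to the Lagrange constant.\<close>

lemma abs_err: "of_int (den (Suc n)) * \<bar>err (Suc n)\<bar> = 1 / lam n" and lam_pos: "lam n > 0"
proof -
  let ?q = "real_of_int (den (Suc n))" and ?q' = "real_of_int (den n)"
  have q: "?q > 0" "?q' \<ge> 0" using den_Suc_ge_1[of n] den_nonneg[of n] by simp_all
  have x: "x (Suc n) > 1" by (rule gt_1)
  then show pos: "lam n > 0" unfolding lam_def using q by (intro add_pos_nonneg) auto
  have "?q * err n - ?q' * err (Suc n) = of_int (num (Suc n) * den n - num n * den (Suc n))"
    by (simp add: err_def algebra_simps)
  then have "- err (Suc n) * (?q * x (Suc n) + ?q') = (- 1) ^ Suc n"
    unfolding det err_Suc[of n] by (simp add: algebra_simps)
  then have "\<bar>- err (Suc n) * (?q * x (Suc n) + ?q')\<bar> = \<bar>(- 1) ^ Suc n\<bar>" by (rule arg_cong)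
  then have "\<bar>err (Suc n)\<bar> * (?q * x (Suc n) + ?q') = 1"
    using q x by (simp add: abs_mult power_abs)
  moreover have "?q * x (Suc n) + ?q' = ?q * lam n"
    using q by (simp add: lam_def field_simps)
  ultimately show "?q * \<bar>err (Suc n)\<bar> = 1 / lam n"
    using pos by (simp add: eq_divide_eq mult.commute mult.left_commute)
qed

lemma err_nonzero: "err (Suc n) \<noteq> 0"
  using abs_err[of n] lam_pos[of n] by auto

text \<open>For a fraction with denominator \<open>q\<close>, the product of \<open>q\<close> and an
  error is a non-zero integer; but errors are below \<open>1 / den (Suc n)\<close>, and the
  denominators outgrow \<open>q\<close>.\<close>

lemma irrational: "x 0 \<notin> \<rat>"
proof
  assume "x 0 \<in> \<rat>"
  then obtain p q :: int where q: "q > 0" and pq: "x 0 = of_int p / of_int q"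
    by (auto elim: Rats_cases')
  define n where "n = nat q"
  have "of_int q * err (Suc n) = of_int (den (Suc n) * p - q * num (Suc n))"
    using q by (simp add: err_def pq field_simps)
  moreover have "of_int q * err (Suc n) \<noteq> 0" using q err_nonzero by simp
  ultimately have "\<bar>of_int q * err (Suc n)\<bar> \<ge> 1"
    by (metis abs_of_int_ge_1 of_int_0)
  then have "of_int q * \<bar>err (Suc n)\<bar> \<ge> 1" using q by (simp add: abs_mult)
  moreover have "of_int (den (Suc n)) * \<bar>err (Suc n)\<bar> < 1"
  proof -
    have "lam n > 1"
      using gt_1[of n] den_nonneg[of n] den_Suc_ge_1[of n] unfolding lam_def
      by (smt (verit) divide_nonneg_nonneg of_int_0_le_iff)
    then show ?thesis using abs_err[of n] by simp
  qed
  ultimately have "of_int (den (Suc n)) * \<bar>err (Suc n)\<bar> < of_int q * \<bar>err (Suc n)\<bar>" by linarith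
  then have "den (Suc n) < q" by (simp add: mult_less_cancel_right)
  then show False using den_ge[of n] q by (simp add: n_def)
qed

text \<open>Legendre's theorem. If \<open>(p, q)\<close> is not proportional to the convergent with the largest
  denominator not exceeding \<open>q\<close>, then it approximates \<open>x 0\<close> no better than that convergent
  does, and the non-zero integer determinant of the two pairs bounds the error from below.\<close>

lemma approximation_cases:
  fixes p q :: int
  assumes "q \<ge> 1"
  obtains "1 / 2 \<le> \<bar>of_int q * (of_int q * x 0 - of_int p)\<bar>"
  | n where "q < den (Suc (Suc n))" "1 / lam n \<le> \<bar>of_int q * (of_int q * x 0 - of_int p)\<bar>"
proof -
  have "\<exists>m. q < den m" using den_ge[of "nat q + 1"] by (intro exI[of _ "Suc (nat q + 1)"]) linarith
  define m where "m = (LEAST m. q < den m)"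
  have m: "q < den m" unfolding m_def by (rule LeastI_ex) fact
  have "m \<noteq> 0" "m \<noteq> 1" using m assms by (auto intro!: gr0I)
  then obtain n where n: "m = Suc (Suc n)" by (metis One_nat_def not0_implies_Suc)
  have le: "den (Suc n) \<le> q" using not_less_Least[of "Suc n" "\<lambda>m. q < den m"] n by (simp add: m_def)
  define q1 q2 where "q1 = den (Suc n)" and "q2 = den (Suc (Suc n))"
  have q12: "q1 \<le> q" "q < q2" "q1 \<ge> 1"
    using le m n den_Suc_ge_1[of n] by (simp_all add: q1_def q2_def)
  define s :: int where "s = (- 1) ^ n"
  have s: "s = 1 \<or> s = - 1" by (cases "even n") (simp_all add: s_def)
  \<comment> \<open>By Cramer's rule, \<open>y\<close> and \<open>- z\<close> are the integer
    coordinates of \<open>(p, q)\<close> in the basis of two consecutive convergents, whose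
    determinant is \<open>s\<close>.\<close>
  define y z where "y = s * (p * q1 - q * num (Suc n))"
    and "z = s * (p * q2 - q * num (Suc (Suc n)))"
  have det': "num (Suc (Suc n)) * q1 - num (Suc n) * q2 = s"
    using det[of "Suc n"] by (simp add: q1_def q2_def s_def)
  have ss: "s * s = 1" using s by auto
  have qyz: "q = y * q2 - z * q1"
  proof -
    have "y * q2 - z * q1 = s * q * (num (Suc (Suc n)) * q1 - num (Suc n) * q2)"
      by (simp add: y_def z_def algebra_simps)
    then show ?thesis unfolding det' using ss by (simp add: mult.commute mult.left_commute)
  qed
  have pyz: "p = y * num (Suc (Suc n)) - z * num (Suc n)"
  proof -
    have "y * num (Suc (Suc n)) - z * num (Suc n)
        = s * p * (num (Suc (Suc n)) * q1 - num (Suc n) * q2)"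
      by (simp add: y_def z_def algebra_simps)
    then show ?thesis unfolding det' using ss by (simp add: mult.commute mult.left_commute)
  qed
  define e where "e = of_int q * x 0 - of_int p"
  have e: "e = of_int y * err (Suc (Suc n)) - of_int z * err (Suc n)"
    unfolding e_def err_def by (subst qyz, subst pyz) (simp add: q1_def q2_def algebra_simps)
  show ?thesis
  proof (cases "y = 0")
    case True
    then have "z \<noteq> 0" using qyz assms by auto
    then have "\<bar>real_of_int z\<bar> \<ge> 1" by (rule abs_of_int_ge_1)
    then have "\<bar>e\<bar> \<ge> \<bar>err (Suc n)\<bar>"
      using True mult_right_mono[of 1 "\<bar>real_of_int z\<bar>" "\<bar>err (Suc n)\<bar>"] by (simp add: e abs_mult)
    then have "of_int q1 * \<bar>err (Suc n)\<bar> \<le> of_int q * \<bar>e\<bar>"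
      using q12 by (intro mult_mono) auto
    then have "1 / lam n \<le> \<bar>of_int q * e\<bar>"
      using abs_err[of n] assms by (simp add: abs_mult q1_def)
    then show ?thesis using that(2) q12 by (simp add: e_def q2_def)
  next
    case False
    \<comment> \<open>\<open>1 \<le> q < q2\<close> forces equal signs. As consecutive errors have
      opposite signs, the two contributions to \<open>e\<close> then add up.\<close>
    have yz: "(y \<ge> 1 \<and> z \<ge> 1) \<or> (y \<le> - 1 \<and> z \<le> - 1)"
    proof (cases "y \<ge> 1")
      case True
      then have "q2 \<le> y * q2" using q12 assms by simp
      then have "z * q1 > 0" using qyz q12 by linarith
      then show ?thesis using True q12 by (simp add: zero_less_mult_iff)
    next
      case False
      then have y: "y \<le> - 1" using \<open>y \<noteq> 0\<close> by simp
      then have "y * q2 < 0" using q12 assms by (simp add: mult_less_0_iff)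
      then have "z * q1 < 0" using qyz assms by linarith
      then show ?thesis using y q12 by (simp add: mult_less_0_iff)
    qed
    define t where "t = x (Suc (Suc n))"
    have t: "t > 1" by (simp add: t_def gt_1)
    have e1: "err (Suc n) = - t * err (Suc (Suc n))" unfolding t_def by (rule err_Suc)
    have "e = (of_int y + of_int z * t) * err (Suc (Suc n))"
      unfolding e e1 by (simp add: algebra_simps)
    moreover have "\<bar>of_int y + of_int z * t\<bar> \<ge> t"
      using yz
    proof
      assume a: "y \<ge> 1 \<and> z \<ge> 1"
      then have "real_of_int y \<ge> 1" "1 * t \<le> of_int z * t" using t by (simp_all add: mult_right_mono)
      then show ?thesis by linarith
    next
      assume a: "y \<le> - 1 \<and> z \<le> - 1"
      then have "real_of_int y \<le> - 1" "real_of_int z \<le> -1" by simp_all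
      moreover from this(2) have "of_int z * t \<le> (- 1) * t" using t by (intro mult_right_mono) auto
      ultimately show ?thesis by linarith
    qed
    ultimately have ee: "\<bar>e\<bar> \<ge> \<bar>err (Suc n)\<bar>"
      using t by (simp add: e1 abs_mult mult_right_mono)
    have "of_int q * err (Suc n) - of_int q1 * e = of_int (p * q1 - q * num (Suc n))"
      by (simp add: e_def err_def q1_def algebra_simps)
    moreover have "\<bar>real_of_int (p * q1 - q * num (Suc n))\<bar> \<ge> 1"
      using False by (intro abs_of_int_ge_1) (auto simp: y_def)
    ultimately have "1 \<le> \<bar>of_int q * err (Suc n)\<bar> + \<bar>of_int q1 * e\<bar>" by linarith
    also have "\<dots> \<le> of_int q * \<bar>e\<bar> + of_int q * \<bar>e\<bar>"
      using q12 assms ee unfolding abs_mult by (intro add_mono mult_mono) auto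
    finally have "1 / 2 \<le> of_int q * \<bar>e\<bar>" by linarith
    then have "1 / 2 \<le> \<bar>of_int q * e\<bar>" using assms by (simp add: abs_mult)
    then show ?thesis using that(1) by (simp add: e_def)
  qed
qed

text \<open>Only finitely many pairs have an error below \<open>1 / M\<close>:
  \<open>M \<ge> 2\<close> excludes the first alternative of \<open>approximation_cases\<close>, the
  second bounds \<open>q\<close> because \<open>n\<close> must be small, and \<open>q\<close> bounds
  \<open>p\<close>.\<close>

lemma lagrange_constant_le:
  assumes M: "M \<ge> 2" and ev: "\<forall>\<^sub>F n in sequentially. lam n \<le> M"
  shows "lagrange_constant (x 0) \<le> ereal M"
proof -
  let ?f = "\<lambda>(p :: int, q :: nat). \<bar>of_nat q * (of_nat q * x 0 - of_int p)\<bar>"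
  from ev obtain N where N: "\<And>n. n \<ge> N \<Longrightarrow> lam n \<le> M" by (auto simp: eventually_sequentially)
  define Q where "Q = den (Suc (Suc N))"
  define Z where "Z = \<lceil>of_int Q * \<bar>x 0\<bar>\<rceil> + 1"
  have "{(p, q). q \<ge> 1 \<and> \<not> 1 / M \<le> ?f (p, q)} \<subseteq> {- Z..Z} \<times> {..nat Q}"
  proof
    fix z :: "int \<times> nat" assume "z \<in> {(p, q). q \<ge> 1 \<and> \<not> 1 / M \<le> ?f (p, q)}"
    then obtain p q where z: "z = (p, q)" and q: "q \<ge> 1"
      and lt: "\<not> 1 / M \<le> \<bar>of_nat q * (of_nat q * x 0 - of_int p)\<bar>"
      by auto
    have "1 / M \<le> 1 / 2" using M by simp
    with lt have lt2: "\<not> 1 / 2 \<le> \<bar>of_nat q * (of_nat q * x 0 - of_int p)\<bar>" by linarith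
    have "int q \<ge> 1" using q by simp
    then have qQ: "int q \<le> Q"
    proof (cases rule: approximation_cases[of "int q" p])
      case 1
      then show ?thesis using lt2 by simp
    next
      case (2 n)
      have "\<not> n \<ge> N"
      proof
        assume "n \<ge> N"
        then have "1 / M \<le> 1 / lam n" using N lam_pos by (simp add: frac_le)
        then show False using lt 2(2) by simp
      qed
      then have "den (Suc (Suc n)) \<le> Q" unfolding Q_def by (intro den_mono) simp
      then show ?thesis using 2(1) by simp
    qed
    have "\<bar>of_nat q * x 0 - of_int p\<bar> \<le> of_nat q * \<bar>of_nat q * x 0 - of_int p\<bar>"
      using q mult_right_mono[of 1 "real q" "\<bar>of_nat q * x 0 - of_int p\<bar>"] by simp
    also have "\<dots> < 1" using lt2 by (simp add: abs_mult)
    finally have "\<bar>real_of_int p\<bar> \<le> \<bar>of_nat q * x 0\<bar> + 1" by linarith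
    moreover have "\<bar>of_nat q * x 0\<bar> \<le> of_int Q * \<bar>x 0\<bar>"
      using qQ by (simp add: abs_mult mult_right_mono)
    ultimately have "\<bar>real_of_int p\<bar> \<le> of_int Z" unfolding Z_def by linarith
    then show "z \<in> {- Z..Z} \<times> {..nat Q}" using qQ by (auto simp: z)
  qed
  then have "finite {(p, q). q \<ge> 1 \<and> \<not> 1 / M \<le> ?f (p, q)}"
    by (rule finite_subset) auto
  then have "\<forall>\<^sub>F z in inf cofinite (principal {(p :: int, q :: nat). q \<ge> 1}). ereal (1 / M) \<le> ereal (?f z)"
    unfolding eventually_inf_principal eventually_cofinite by (rule rev_finite_subset) auto
  then have "ereal (1 / M) \<le> Liminf (inf cofinite (principal {(p :: int, q :: nat). q \<ge> 1})) (\<lambda>z. ereal (?f z))"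
    by (rule Liminf_bounded)
  then have "inverse (Liminf (inf cofinite (principal {(p :: int, q :: nat). q \<ge> 1})) (\<lambda>z. ereal (?f z)))
      \<le> inverse (ereal (1 / M))"
    using M by (intro ereal_inverse_antimono) auto
  then show ?thesis
    using M unfolding lagrange_constant_def by (simp add: case_prod_beta')
qed

text \<open>Convergents with \<open>lam n \<ge> m\<close> have error at most \<open>1 / m\<close>.
  Their denominators are unbounded, so no cofinite set of pairs avoids them.\<close>

lemma lagrange_constant_ge:
  assumes m: "m > 0" and inf: "\<exists>\<^sub>F n in sequentially. lam n \<ge> m"
  shows "ereal m \<le> lagrange_constant (x 0)"
proof -
  let ?f = "\<lambda>(p :: int, q :: nat). \<bar>of_nat q * (of_nat q * x 0 - of_int p)\<bar>"
  let ?F = "inf cofinite (principal {(p :: int, q :: nat). q \<ge> 1})"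
  let ?L = "Liminf ?F (\<lambda>z. ereal (?f z))"
  have "?L \<le> ereal (1 / m)"
  proof (rule ccontr)
    assume "\<not> ?L \<le> ereal (1 / m)"
    then have "\<forall>\<^sub>F z in ?F. ereal (1 / m) < ereal (?f z)"
      by (intro less_LiminfD) auto
    then have fin: "finite {z. \<not> (z \<in> {(p, q). q \<ge> 1} \<longrightarrow> 1 / m < ?f z)}" (is "finite ?S")
      unfolding eventually_inf_principal eventually_cofinite by (rule rev_finite_subset) auto
    define Z where "Z = Max (snd ` ?S)"
    have "n \<le> Z" if n: "lam n \<ge> m" for n
    proof -
      have d: "den (Suc n) \<ge> 1" by (rule den_Suc_ge_1)
      then have "?f (num (Suc n), nat (den (Suc n))) = 1 / lam n"
        using abs_err[of n] by (simp add: err_def abs_mult)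
      also have "\<dots> \<le> 1 / m" using n m by (simp add: frac_le)
      finally have "(num (Suc n), nat (den (Suc n))) \<in> ?S" using d by auto
      then have "nat (den (Suc n)) \<le> Z" unfolding Z_def using fin by (intro Max_ge) force+
      then show ?thesis using den_ge[of n] by linarith
    qed
    then have "\<forall>\<^sub>F n in sequentially. \<not> lam n \<ge> m"
      unfolding eventually_sequentially by (intro exI[of _ "Suc Z"]) force
    then show False using inf by (simp add: frequently_def)
  qed
  moreover have "0 \<le> ?L" by (intro Liminf_bounded always_eventually) auto
  ultimately have "inverse (ereal (1 / m)) \<le> inverse ?L" by (intro ereal_inverse_antimono)
  then show ?thesis using m unfolding lagrange_constant_def by (simp add: case_prod_beta')
qed

end

section \<open>Two-sided sequences\<close>

definition forward_cf :: "(int \<Rightarrow> int) \<Rightarrow> int \<Rightarrow> real" where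
  "forward_cf C i = cfrac (\<lambda>k. C (i + int k))"

definition backward_cf :: "(int \<Rightarrow> int) \<Rightarrow> int \<Rightarrow> real" where
  "backward_cf C i = cfrac (\<lambda>k. C (i - int k))"

lemma backward_cf_eq: "backward_cf C i = forward_cf (\<lambda>t. C (- t)) (- i)"
  by (simp add: forward_cf_def backward_cf_def add.commute)

context
  fixes C :: "int \<Rightarrow> int"
  assumes pos: "\<forall>t. C t \<ge> 1"
begin

lemma forward_cf_unfold: "forward_cf C i = of_int (C i) + 1 / forward_cf C (i + 1)"
  using cfrac_unfold[of "\<lambda>k. C (i + int k)"] pos by (simp add: forward_cf_def add.assoc)

lemma forward_cf_bounds: "of_int (C i) < forward_cf C i" "forward_cf C i \<le> of_int (C i) + 1"
  using cfrac_bounds[of "\<lambda>k. C (i + int k)"] pos by (simp_all add: forward_cf_def)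

lemma forward_cf_gt_1: "forward_cf C i > 1"
proof -
  have "real_of_int (C i) \<ge> 1" using pos by simp
  then show ?thesis using forward_cf_bounds(1)[of i] by linarith
qed

text \<open>Both tails contain \<open>C i\<close>, which is therefore subtracted once. Unlike the
  definition, this form is visibly symmetric under reversal.\<close>

lemma biinf_lambda_eq: "biinf_lambda C i = backward_cf C i + forward_cf C i - of_int (C i)"
  using cfrac_unfold[of "\<lambda>k. if k = 0 then 0 else C (i + int k)"] pos forward_cf_unfold[of i]
  by (simp add: biinf_lambda_def backward_cf_def forward_cf_def add.assoc)

lemma cf_expansion_forward_cf: "cf_expansion (\<lambda>n. C (int n)) (\<lambda>n. forward_cf C (int n))"
proof
  show "forward_cf C (int n) = of_int (C (int n)) + 1 / forward_cf C (int (Suc n))" for n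
    using forward_cf_unfold[of "int n"] by (simp add: add.commute)
qed (rule forward_cf_gt_1)

end

lemma backward_cf_unfold:
  "\<forall>t. C t \<ge> 1 \<Longrightarrow> backward_cf C i = of_int (C i) + 1 / backward_cf C (i - 1)"
  using forward_cf_unfold[of "\<lambda>t. C (- t)" "- i"] by (simp add: backward_cf_eq)

lemma backward_cf_gt_1: "\<forall>t. C t \<ge> 1 \<Longrightarrow> backward_cf C i > 1"
  by (simp add: backward_cf_eq forward_cf_gt_1)

lemma cf_expansion_complete_quotient:
  assumes "\<alpha> \<notin> \<rat>"
  shows "cf_expansion (partial_quotient \<alpha>) (complete_quotient \<alpha>)"
proof
  have irr: "complete_quotient \<alpha> n \<notin> \<rat>" for n
  proof (induction n)
    case (Suc n)
    then have "frac (complete_quotient \<alpha> n) \<notin> \<rat>"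
      unfolding frac_def by (metis Rats_add Rats_of_int diff_add_cancel)
    then show ?case
      by (metis Rats_inverse complete_quotient.simps(2) inverse_eq_divide inverse_inverse_eq)
  qed (use assms in simp)
  have pos: "frac (complete_quotient \<alpha> n) > 0" for n
    using irr[of n] frac_ge_0[of "complete_quotient \<alpha> n"] by (metis Ints_subset_Rats frac_gt_0_iff subsetD)
  fix n
  show "complete_quotient \<alpha> n = of_int (partial_quotient \<alpha> n) + 1 / complete_quotient \<alpha> (Suc n)"
    by (simp add: partial_quotient_def frac_def)
  show "complete_quotient \<alpha> (Suc n) > 1"
    using pos[of n] frac_lt_1[of "complete_quotient \<alpha> n"] by simp
qed

text \<open>\<open>chain_close\<close> compares \<open>x (Suc n)\<close> with the right tail, and
  the quotient of denominators, a finite continued fraction of the preceding letters read backwards,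
  with the left tail. The condition on \<open>n\<close> keeps the block at positions at least
  1.\<close>

lemma (in cf_expansion) lam_close:
  assumes C: "\<forall>t. C t \<ge> 1" and n: "2 * N < n"
    and agree: "\<And>j. j \<le> 4 * N \<Longrightarrow> a (Suc n - 2 * N + j) = C (i - 2 * int N + int j)"
  shows "\<bar>lam n - biinf_lambda C i\<bar> \<le> 2 * (1 / 4) ^ N"
proof -
  have fw: "a (Suc n + k) = C (i + int k)" if "k \<le> 2 * N" for k
    using agree[of "2 * N + k"] that n by (simp add: Suc_diff_le)
  have bw: "a (Suc n - k) = C (i - int k)" if "k \<le> 2 * N" for k
    using agree[of "2 * N - k"] that n by (simp add: of_nat_diff Suc_diff_le)
  have "\<bar>x (Suc n + 0) - forward_cf C (i + int 0)\<bar> \<le> (1 / 4) ^ N"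
  proof (rule chain_close[where c = "\<lambda>k. C (i + int k)"])
    show "x (Suc n + k) = of_int (C (i + int k)) + 1 / x (Suc n + Suc k)" if "k \<le> 2 * N" for k
      using unfold[of "Suc n + k"] fw[OF that] by simp
    show "forward_cf C (i + int k) = of_int (C (i + int k)) + 1 / forward_cf C (i + int (Suc k))" for k
      using forward_cf_unfold[OF C, of "i + int k"] by (simp add: algebra_simps)
    show "x (Suc n + k) \<ge> 1" for k using gt_1[of "n + k"] by simp
    show "forward_cf C (i + int k) \<ge> 1" for k using forward_cf_gt_1[OF C, of "i + int k"] by simp
  qed (use C in auto)
  moreover
  \<comment> \<open>For \<open>k \<le> n\<close> this is
    \<open>den (Suc (Suc n) - k) / den (Suc n - k)\<close>, so the recurrence of \<open>den\<close>
    becomes the recursion needed.\<close>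
  define y where "y = (\<lambda>k. of_int (a (Suc n - k)) + of_int (den (n - k)) / (of_int (den (Suc n - k)) :: real))"
  have y_ge: "y k \<ge> 1" if "k \<le> n" for k
  proof -
    have "real_of_int (a (Suc n - k)) \<ge> 1" using a_ge_1[of "n - k"] that by (simp add: Suc_diff_le)
    then show ?thesis using den_nonneg by (simp add: y_def add_increasing2)
  qed
  have "\<bar>y 0 - backward_cf C (i - int 0)\<bar> \<le> (1 / 4) ^ N"
  proof (rule chain_close[where c = "\<lambda>k. C (i - int k)"])
    fix k assume k: "k \<le> 2 * N"
    then obtain m where m: "n - k = Suc m" using n by (metis Suc_diff_Suc le_less_trans)
    then have m': "Suc n - k = Suc (Suc m)" "Suc n - Suc k = Suc m" "n - Suc k = m" by simp_all
    have "real_of_int (den (Suc m)) > 0" using den_Suc_ge_1[of m] by simp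
    then have "1 / y (Suc k) = of_int (den (Suc m)) / of_int (den (Suc (Suc m)))"
      unfolding y_def m' den.simps(3) by (simp add: add_divide_eq_iff)
    then show "y k = of_int (C (i - int k)) + 1 / y (Suc k)"
      using bw[OF k] by (simp add: y_def m m')
  next
    show "backward_cf C (i - int k) = of_int (C (i - int k)) + 1 / backward_cf C (i - int (Suc k))" for k
      using backward_cf_unfold[OF C, of "i - int k"] by (simp add: algebra_simps)
    show "y k \<ge> 1" if "k \<le> Suc (2 * N)" for k using y_ge that n by simp
    show "backward_cf C (i - int k) \<ge> 1" for k using backward_cf_gt_1[OF C, of "i - int k"] by simp
  qed (use C in auto)
  moreover have "lam n = x (Suc n) + (y 0 - of_int (C i))"
    using fw[of 0] by (simp add: lam_def y_def)
  ultimately show ?thesis by (simp add: biinf_lambda_eq[OF C])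
qed

section \<open>Periodic sequences and their Lagrange constants\<close>

lemma quarter_power_less: "e > 0 \<Longrightarrow> \<exists>N. 2 * (1 / 4) ^ N < (e :: real)"
  using real_arch_pow_inv[of "e / 2" "1 / 4"] by (auto simp: mult.commute)

lemma periodic_shift:
  fixes C :: "int \<Rightarrow> int"
  assumes "\<forall>t. C (t + P) = C t"
  shows "C (t + int k * P) = C t"
proof (induction k)
  case (Suc k)
  then show ?case using assms[rule_format, of "t + int k * P"] by (simp add: algebra_simps)
qed simp

text \<open>For a periodic sequence, the numbers \<open>\<lambda>\<^sub>i(\<beta>)\<close> of the one-sided half approach the
  two-sided ones, each of which recurs with every period.\<close>

lemma periodic_lagrange_constant:
  assumes C: "\<forall>t. C t \<ge> 1" and P: "P > 0" and per: "\<forall>t. C (t + P) = C t"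
    and M: "M \<ge> 2" and le: "\<And>i. biinf_lambda C i \<le> M"
  obtains \<beta> where "\<beta> \<notin> \<rat>" "ereal (biinf_lambda C 0) \<le> lagrange_constant \<beta>"
    "lagrange_constant \<beta> \<le> ereal M"
proof -
  interpret cf_expansion "\<lambda>n. C (int n)" "\<lambda>n. forward_cf C (int n)"
    by (rule cf_expansion_forward_cf[OF C])
  have close: "\<forall>\<^sub>F n in sequentially. \<bar>lam n - biinf_lambda C (int (Suc n))\<bar> < e" if "e > 0" for e
  proof -
    obtain N where N: "2 * (1 / 4) ^ N < e" using quarter_power_less[OF \<open>e > 0\<close>] by blast
    have "\<bar>lam n - biinf_lambda C (int (Suc n))\<bar> < e" if "2 * N < n" for n
    proof -
      have "\<bar>lam n - biinf_lambda C (int (Suc n))\<bar> \<le> 2 * (1 / 4) ^ N"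
      proof (rule lam_close[OF C that])
        show "C (int (Suc n - 2 * N + j)) = C (int (Suc n) - 2 * int N + int j)" for j
          using that by (simp add: of_nat_diff algebra_simps)
      qed
      with N show ?thesis by linarith
    qed
    then show ?thesis by (auto simp: eventually_at_top_dense)
  qed
  have lambda_per: "biinf_lambda C (int k * P) = biinf_lambda C 0" for k
  proof -
    have "C (int k * P - int j) = C (- int j)" "C (int k * P + int j) = C (int j)" for j
      using periodic_shift[OF per, of "- int j" k] periodic_shift[OF per, of "int j" k]
      by (simp_all add: algebra_simps)
    then show ?thesis by (simp add: biinf_lambda_def cong: if_cong)
  qed
  have rec: "\<exists>n\<ge>m. biinf_lambda C (int (Suc n)) = biinf_lambda C 0" for m
  proof -
    define K where "K = int (Suc m) * P"
    have "K \<ge> int (Suc m) * 1" unfolding K_def using P by (intro mult_left_mono) auto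
    then have "nat (K - 1) \<ge> m" "int (Suc (nat (K - 1))) = K" by (simp_all add: le_nat_iff)
    moreover have "biinf_lambda C K = biinf_lambda C 0" unfolding K_def by (rule lambda_per)
    ultimately show ?thesis by metis
  qed
  have gt1: "biinf_lambda C i > 1" for i
    using forward_cf_gt_1[OF C, of i] backward_cf_unfold[OF C, of i] backward_cf_gt_1[OF C, of "i - 1"]
    by (simp add: biinf_lambda_eq[OF C]) (smt (verit) divide_pos_pos)
  show thesis
  proof
    show "forward_cf C (int 0) \<notin> \<rat>" by (rule irrational)
    show "lagrange_constant (forward_cf C (int 0)) \<le> ereal M"
    proof (rule ereal_le_epsilon2)
      fix e :: real assume e: "e > 0"
      have "lagrange_constant (forward_cf C (int 0)) \<le> ereal (M + e)"
      proof (intro lagrange_constant_le)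
        show "\<forall>\<^sub>F n in sequentially. lam n \<le> M + e"
          using close[OF e]
        proof (rule eventually_mono)
          fix n assume "\<bar>lam n - biinf_lambda C (int (Suc n))\<bar> < e"
          then show "lam n \<le> M + e" using le[of "int (Suc n)"] by linarith
        qed
      qed (use M e in simp)
      then show "lagrange_constant (forward_cf C (int 0)) \<le> ereal M + ereal e" by simp
    qed
    show "ereal (biinf_lambda C 0) \<le> lagrange_constant (forward_cf C (int 0))"
    proof (rule ereal_le_epsilon2)
      fix e :: real assume e: "e > 0"
      \<comment> \<open>The maximum keeps \<open>m\<close> positive, as
        \<open>lagrange_constant_ge\<close> requires, and still below
        \<open>biinf_lambda C 0\<close>, which exceeds 1.\<close>
      define m where "m = max (1 / 2) (biinf_lambda C 0 - e)"
      define d where "d = biinf_lambda C 0 - m"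
      have d: "d > 0" using gt1[of 0] e by (simp add: d_def m_def)
      have "\<exists>\<^sub>F n in sequentially. lam n \<ge> m"
        unfolding frequently_sequentially
      proof
        fix k
        obtain n0 where n0: "\<And>n. n \<ge> n0 \<Longrightarrow> \<bar>lam n - biinf_lambda C (int (Suc n))\<bar> < d"
          using close[OF d] by (auto simp: eventually_sequentially)
        obtain n where "n \<ge> max k n0" "biinf_lambda C (int (Suc n)) = biinf_lambda C 0"
          using rec by blast
        then show "\<exists>n\<ge>k. lam n \<ge> m" using n0[of n] by (intro exI[of _ n]) (simp add: d_def)
      qed
      then have "ereal m \<le> lagrange_constant (forward_cf C (int 0))"
        by (intro lagrange_constant_ge) (simp_all add: m_def)
      moreover have "biinf_lambda C 0 \<le> m + e" by (simp add: m_def)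
      then have "ereal (biinf_lambda C 0) \<le> ereal m + ereal e" by simp
      ultimately show "ereal (biinf_lambda C 0) \<le> lagrange_constant (forward_cf C (int 0)) + ereal e"
        by (meson add_right_mono order.trans)
    qed
  qed
qed

section \<open>Recurrent blocks and the effect of the gap\<close>

definition window :: "(int \<Rightarrow> int) \<Rightarrow> nat \<Rightarrow> int \<Rightarrow> int list" where
  "window C l t = map (\<lambda>j. C (t + int j)) [0..<l]"

definition quotient_block :: "real \<Rightarrow> nat \<Rightarrow> nat \<Rightarrow> int list" where
  "quotient_block \<alpha> l k = map (\<lambda>j. partial_quotient \<alpha> (k + j)) [0..<l]"

definition recurrent_blocks :: "real \<Rightarrow> nat \<Rightarrow> int list set" where
  "recurrent_blocks \<alpha> l = {w. infinite {k. k \<ge> 1 \<and> quotient_block \<alpha> l k = w}}"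

lemma eventually_lam_le:
  assumes "\<alpha> \<notin> \<rat>" "lagrange_constant \<alpha> = ereal a" "a > 0" "e > 0"
  shows "\<forall>\<^sub>F n in sequentially. cf_expansion.lam (partial_quotient \<alpha>) (complete_quotient \<alpha>) n \<le> a + e"
proof (rule ccontr)
  interpret cf_expansion "partial_quotient \<alpha>" "complete_quotient \<alpha>"
    by (rule cf_expansion_complete_quotient) fact
  assume "\<not> ?thesis"
  then have "\<exists>\<^sub>F n in sequentially. lam n \<ge> a + e"
    by (auto simp: not_eventually not_le elim: frequently_elim1)
  then have "ereal (a + e) \<le> lagrange_constant (complete_quotient \<alpha> 0)"
    using assms by (intro lagrange_constant_ge) auto
  then show False using assms by simp
qed

text \<open>A recurrent window also occurs in the expansion of \<alpha> so far out that
  \<open>lam\<close> is at most \<open>a + e / 2\<close>; sharing \<open>4 * N + 1\<close> letters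
  then costs less than \<open>e / 2\<close>.\<close>

lemma recurrent_window_bound:
  assumes \<alpha>: "\<alpha> \<notin> \<rat>" "lagrange_constant \<alpha> = ereal a" "a > 0" and e: "e > 0"
  obtains N where "\<And>C i. \<forall>t. C t \<ge> 1 \<Longrightarrow>
    window C (4 * N + 1) (i - 2 * int N) \<in> recurrent_blocks \<alpha> (4 * N + 1) \<Longrightarrow> biinf_lambda C i \<le> a + e"
proof -
  interpret cf_expansion "partial_quotient \<alpha>" "complete_quotient \<alpha>"
    by (rule cf_expansion_complete_quotient) fact
  have "e / 2 > 0" using e by simp
  obtain N where N: "2 * (1 / 4) ^ N < e / 2" using quarter_power_less[OF \<open>e / 2 > 0\<close>] by blast
  obtain n0 where n0: "\<And>n. n \<ge> n0 \<Longrightarrow> lam n \<le> a + e / 2"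
    using eventually_lam_le[OF \<alpha> \<open>e / 2 > 0\<close>] by (auto simp: eventually_sequentially)
  have "biinf_lambda C i \<le> a + e"
    if C: "\<forall>t. C t \<ge> 1"
      and win: "window C (4 * N + 1) (i - 2 * int N) \<in> recurrent_blocks \<alpha> (4 * N + 1)" for C i
  proof -
    from win obtain k where k: "k \<ge> n0 + 2"
      "quotient_block \<alpha> (4 * N + 1) k = window C (4 * N + 1) (i - 2 * int N)"
      unfolding recurrent_blocks_def infinite_nat_iff_unbounded_le by blast
    \<comment> \<open>\<open>lam n\<close> is centred at \<open>Suc n = k + 2 * N\<close>, the
      middle of the block starting at \<open>k\<close>.\<close>
    define n where "n = k + 2 * N - 1"
    have "\<bar>lam n - biinf_lambda C i\<bar> \<le> 2 * (1 / 4) ^ N"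
    proof (rule lam_close[OF C])
      show "2 * N < n" using k by (simp add: n_def)
      fix j assume "j \<le> 4 * N"
      then show "partial_quotient \<alpha> (Suc n - 2 * N + j) = C (i - 2 * int N + int j)"
        using k by (simp add: n_def quotient_block_def window_def del: upt_Suc)
    qed
    moreover have "lam n \<le> a + e / 2" using k by (intro n0) (simp add: n_def)
    ultimately show ?thesis using N by linarith
  qed
  then show thesis using that by blast
qed

text \<open>With \<open>e\<close> half the gap, \<open>recurrent_window_bound\<close> keeps all
  \<open>biinf_lambda C i\<close> at most \<open>a + e < b\<close>. The number obtained from
  \<open>C\<close> has its Lagrange constant between \<open>biinf_lambda C 0\<close> and
  \<open>a + e\<close>; being in the spectrum, this constant is at most \<open>a\<close>.\<close>

lemma periodic_lambda_le_gap:
  assumes gap: "maximal_gap a b" and \<alpha>: "\<alpha> \<notin> \<rat>" "lagrange_constant \<alpha> = ereal a" and a: "a \<ge> 2"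
  obtains l where "l \<ge> 1" "\<And>C P. \<lbrakk>\<forall>t. C t \<ge> 1; P > 0; \<forall>t. C (t + P) = C t;
    \<forall>t. window C l t \<in> recurrent_blocks \<alpha> l\<rbrakk> \<Longrightarrow> biinf_lambda C 0 \<le> a"
proof -
  define e where "e = (b - a) / 2"
  have e: "e > 0" "a + e < b" using gap by (simp_all add: e_def maximal_gap_def field_simps)
  obtain N where N: "\<And>C i. \<forall>t. C t \<ge> 1 \<Longrightarrow>
    window C (4 * N + 1) (i - 2 * int N) \<in> recurrent_blocks \<alpha> (4 * N + 1) \<Longrightarrow> biinf_lambda C i \<le> a + e"
    using recurrent_window_bound[OF \<alpha> _ e(1)] a by auto
  have "biinf_lambda C 0 \<le> a"
    if C: "\<forall>t. C t \<ge> 1" "P > 0" "\<forall>t. C (t + P) = C t"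
      and win: "\<forall>t. window C (4 * N + 1) t \<in> recurrent_blocks \<alpha> (4 * N + 1)" for C P
  proof -
    obtain \<beta> where \<beta>: "\<beta> \<notin> \<rat>" "ereal (biinf_lambda C 0) \<le> lagrange_constant \<beta>"
      "lagrange_constant \<beta> \<le> ereal (a + e)"
      using periodic_lagrange_constant[OF C, of "a + e"] N[OF C(1)] win a e by auto
    then obtain c where c: "lagrange_constant \<beta> = ereal c"
      by (cases "lagrange_constant \<beta>") auto
    then have "c \<in> lagrange_spectrum" using \<beta> by (auto simp: lagrange_spectrum_def)
    then have "\<not> (a < c \<and> c < b)" using gap by (auto simp: maximal_gap_def)
    then show ?thesis using \<beta> c e by auto
  qed
  then show thesis using that[of "4 * N + 1"] by auto
qed

section \<open>Sequences with blocks in a connected finite set\<close>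

lemma length_window [simp]: "length (window C l t) = l"
  by (simp add: window_def)

lemma window_nth [simp]: "j < l \<Longrightarrow> window C l t ! j = C (t + int j)"
  by (simp add: window_def)

lemma window_eq_iff: "window C l t = window D l u \<longleftrightarrow> (\<forall>j<l. C (t + int j) = D (u + int j))"
  by (auto simp: list_eq_iff_nth_eq)

lemma window_reverse: "window (\<lambda>t. C (- t)) l t = rev (window C l (1 - t - int l))"
  by (auto simp: list_eq_iff_nth_eq rev_nth of_nat_diff algebra_simps intro!: arg_cong[of _ _ C])

text \<open>An abstract block set \<open>F\<close>, so that the reversed sequence is covered as
  well. \<open>connected\<close> gives a path through \<open>F\<close>, with
  \<open>n \<ge> l\<close> keeping its end blocks disjoint for splicing; \<open>maximal\<close> is
  what the gap yields.\<close>

locale block_system =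
  fixes l :: nat and F :: "int list set" and A :: int and B :: "int \<Rightarrow> int"
  assumes l_ge_1: "l \<ge> 1"
    and letters: "w \<in> F \<Longrightarrow> set w \<subseteq> {1..A}"
    and window_B: "window B l t \<in> F"
    and connected: "w \<in> F \<Longrightarrow> v \<in> F \<Longrightarrow> \<exists>s n. n \<ge> l \<and> window s l 0 = w \<and> window s l (int n) = v \<and>
      (\<forall>t. 0 \<le> t \<and> t \<le> int n \<longrightarrow> window s l t \<in> F)"
    and maximal: "\<lbrakk>\<forall>t. C t \<ge> 1; P > 0; \<forall>t. C (t + P) = C t; \<forall>t. window C l t \<in> F\<rbrakk>
      \<Longrightarrow> biinf_lambda C 0 \<le> biinf_lambda B 0"
begin

lemma letter_bounds:
  assumes "\<forall>t. window C l t \<in> F"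
  shows "1 \<le> C t" "C t \<le> A"
proof -
  have "window C l t ! 0 \<in> set (window C l t)" using l_ge_1 by (intro nth_mem) simp
  then have "C t \<in> {1..A}" using letters assms l_ge_1 by fastforce
  then show "1 \<le> C t" "C t \<le> A" by simp_all
qed

text \<open>Follow \<open>B\<close> from \<open>- K\<close> up to \<open>m - 1\<close>, branch off to \<open>d\<close>, and close up the path.\<close>

lemma periodic_branch:
  fixes m K d :: int
  assumes m: "m \<ge> int l" and K: "K \<ge> int l"
    and branch: "window (B(m := d)) l (m - int l + 1) \<in> F"
  obtains C P where "P > 0" "\<forall>t. C (t + P) = C t" "\<forall>t. window C l t \<in> F"
    "\<forall>t. - K \<le> t \<and> t < m \<longrightarrow> C t = B t" "C m = d"
proof -
  define u where "u = m - int l + 1"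
  obtain s n where n: "n \<ge> l" and s0: "window s l 0 = window (B(m := d)) l u"
    and sn: "window s l (int n) = window B l (- K)"
    and sF: "\<And>t. 0 \<le> t \<Longrightarrow> t \<le> int n \<Longrightarrow> window s l t \<in> F"
    using connected[OF branch window_B[of "- K"]] unfolding u_def by blast
  \<comment> \<open>The period runs from \<open>- K\<close> to \<open>P - K = u + n\<close>, where
    the path \<open>s\<close>, shifted by \<open>u\<close>, has come back to the block of
    \<open>B\<close> at \<open>- K\<close>.\<close>
  define P where "P = u + int n + K"
  define G where "G = (\<lambda>t. if t < m then B t else s (t - u))"
  define C where "C = (\<lambda>t. G ((t + K) mod P - K))"
  have P: "P > 0" using m K n l_ge_1 by (simp add: P_def u_def)
  have per: "C (t + P) = C t" for t
  proof -
    have "(t + P + K) mod P = (t + K) mod P" by (metis add.assoc add.commute mod_add_self2)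
    then show ?thesis by (simp add: C_def)
  qed
  have CG: "C t = G t" if "- K \<le> t" "t < P - K" for t
    using that by (simp add: C_def mod_pos_pos_trivial)
  have CB: "C t = B t" if "- K \<le> t" "t < m" for t
    using that CG[of t] n by (simp add: G_def P_def u_def)
  \<comment> \<open>Left of \<open>m\<close> the path starts with the modified block, which agrees
    with \<open>B\<close> there; from \<open>P - K\<close> on its last block is that of
    \<open>B\<close> at \<open>- K\<close>, so it matches the next period.\<close>
  have Cs: "C t = s (t - u)" if t: "u \<le> t" "t \<le> u + int n + int l - 1" for t
  proof -
    consider "t < m" | "m \<le> t" "t < P - K" | "P - K \<le> t" by linarith
    then show ?thesis
    proof cases
      case 1
      have j: "nat (t - u) < l" "int (nat (t - u)) = t - u" using t 1 by (auto simp: u_def)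
      then have "s (t - u) = (B(m := d)) t" using s0 unfolding window_eq_iff by fastforce
      moreover have "C t = B t" using t 1 m K l_ge_1 by (intro CB) (auto simp: u_def)
      ultimately show ?thesis using 1 by simp
    next
      case 2
      then show ?thesis using CG[of t] m K l_ge_1 t by (simp add: G_def u_def)
    next
      case 3
      define j where "j = nat (t - (P - K))"
      have j: "j < l" "t = u + int n + int j" using 3 t l_ge_1 by (auto simp: j_def P_def)
      have "C t = C (- K + int j)" using per[of "- K + int j"] j by (simp add: P_def algebra_simps)
      also have "\<dots> = B (- K + int j)" using j m K by (intro CB) auto
      also have "\<dots> = s (int n + int j)" using sn j unfolding window_eq_iff by simp
      finally show ?thesis using j by simp
    qed
  qed
  have "window C l t \<in> F" for t
  proof -
    define t' where "t' = (t + K) mod P - K"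
    have t': "- K \<le> t'" "t' < P - K" using P by (simp_all add: t'_def)
    have "C (t + int j) = C (t' + int j)" for j
    proof -
      have "(t' + int j + K) mod P = (t + int j + K) mod P"
        unfolding t'_def by (simp add: mod_simps algebra_simps)
      then show ?thesis by (simp add: C_def)
    qed
    then have eq: "window C l t = window C l t'" by (simp add: window_eq_iff)
    \<comment> \<open>A window either ends before \<open>m\<close> and is one of \<open>B\<close>,
      or starts at \<open>u\<close> or later and lies on the path.\<close>
    show ?thesis
    proof (cases "t' + int l \<le> m")
      case True
      then have "window C l t' = window B l t'" using t' CB by (simp add: window_eq_iff)
      then show ?thesis using eq window_B by simp
    next
      case False
      then have "window C l t' = window s l (t' - u)"
        using t' unfolding window_eq_iff by (auto simp: u_def P_def Cs algebra_simps)
      moreover have "0 \<le> t' - u" "t' - u \<le> int n" using False t' by (auto simp: u_def P_def)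
      ultimately show ?thesis using eq sF by simp
    qed
  qed
  moreover have "C m = d"
  proof -
    have "C m = s (m - u)" using n l_ge_1 by (intro Cs) (auto simp: u_def)
    also have "\<dots> = s (0 + int (l - 1))" using l_ge_1 by (simp add: u_def of_nat_diff)
    also have "\<dots> = (B(m := d)) (u + int (l - 1))" 
      using s0[unfolded window_eq_iff, rule_format, of "l - 1"] l_ge_1 by simp
    also have "\<dots> = d" using l_ge_1 by (simp add: u_def of_nat_diff)
    finally show ?thesis .
  qed
  ultimately show thesis using that P per CB by blast
qed

text \<open>Raising the letter at position \<open>m > 0\<close> moves \<open>\<lambda>\<^sub>0\<close> in the direction \<open>(- 1) ^ m\<close>.\<close>

lemma forced_letter:
  assumes m: "m \<ge> l" and branch: "window (B(int m := d)) l (int m - int l + 1) \<in> F"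
  shows "(- 1) ^ m * (d - B (int m)) \<le> 0"
proof (rule ccontr)
  assume contra: "\<not> ?thesis"
  note B_bounds = letter_bounds[OF allI, OF window_B]
  have A: "A \<ge> 1" using B_bounds[of 0] by linarith
  \<comment> \<open>By \<open>chain_separate\<close>, a different letter at \<open>m\<close> moves
    the right tail by at least \<delta>, as all complete quotients lie between 1 and
    \<open>A + 1\<close>.\<close>
  define \<delta> where "\<delta> = (1 / (real_of_int A + 1)) ^ Suc (2 * m)"
  have "\<delta> > 0" using A by (simp add: \<delta>_def)
  then obtain N where N: "2 * (1 / 4) ^ N < \<delta>" using quarter_power_less by blast
  \<comment> \<open>Agreement on \<open>2 * N\<close> letters to the left of 0 makes the left tails
    differ by less than \<delta>; the summand \<open>l\<close> is for
    \<open>periodic_branch\<close>.\<close>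
  define K where "K = int l + 2 * int N"
  obtain C P where P: "P > 0" "\<forall>t. C (t + P) = C t" and CF: "\<forall>t. window C l t \<in> F"
    and CB: "\<forall>t. - K \<le> t \<and> t < int m \<longrightarrow> C t = B t" and Cm: "C (int m) = d"
  proof (rule periodic_branch[of "int m" K d])
    show "int l \<le> int m" "int l \<le> K" using m by (simp_all add: K_def)
  qed (use branch in auto)
  note C_bounds = letter_bounds[OF CF]
  have B1: "\<forall>t. B t \<ge> 1" and C1: "\<forall>t. C t \<ge> 1" using B_bounds C_bounds by auto
  have bnd: "1 \<le> forward_cf D (int k) \<and> forward_cf D (int k) \<le> of_int A + 1"
    if D: "\<forall>t. D t \<ge> 1" "\<And>t. D t \<le> A" for D k
  proof -
    have "real_of_int (D (int k)) \<le> of_int A" using D by simp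
    then show ?thesis
      using forward_cf_bounds(2)[OF D(1), of "int k"] forward_cf_gt_1[OF D(1), of "int k"] by linarith
  qed
  have agree: "C (int k) = B (int k)" if "k < m" for k using CB that by (simp add: K_def)
  have sep: "\<delta> \<le> (- 1) ^ m * (forward_cf E 0 - forward_cf D 0)"
    if D: "\<forall>t. D t \<ge> 1" "\<And>t. D t \<le> A" and E: "\<forall>t. E t \<ge> 1" "\<And>t. E t \<le> A"
      and DE: "\<And>k. k < m \<Longrightarrow> D (int k) = E (int k)" "D (int m) < E (int m)" for D E
  proof -
    have "\<delta> \<le> (- 1) ^ m * (forward_cf E (int 0) - forward_cf D (int 0))"
      unfolding \<delta>_def
    proof (rule chain_separate[where c = "\<lambda>k. D (int k)" and d = "\<lambda>k. E (int k)"])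
      show "forward_cf D (int k) = of_int (D (int k)) + 1 / forward_cf D (int (Suc k))"
        "forward_cf E (int k) = of_int (E (int k)) + 1 / forward_cf E (int (Suc k))" for k
        using forward_cf_unfold[OF D(1), of "int k"] forward_cf_unfold[OF E(1), of "int k"]
        by (simp_all add: add.commute)
    qed (use DE bnd D E in auto)
    then show ?thesis by simp
  qed
  have fw: "\<delta> \<le> forward_cf C 0 - forward_cf B 0"
  proof (cases "even m")
    case True
    then have "B (int m) < C (int m)" using contra Cm by simp
    then have "\<delta> \<le> (- 1) ^ m * (forward_cf C 0 - forward_cf B 0)"
      using agree by (intro sep[OF B1 B_bounds(2) C1 C_bounds(2)]) auto
    then show ?thesis using True by simp
  next
    case False
    then have "C (int m) < B (int m)" using contra Cm by simp
    then have "\<delta> \<le> (- 1) ^ m * (forward_cf B 0 - forward_cf C 0)"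
      using agree by (intro sep[OF C1 C_bounds(2) B1 B_bounds(2)]) auto
    then show ?thesis using False by simp
  qed
  have neg_Suc: "- int (Suc k) = - int k - 1" for k by simp
  have "\<bar>backward_cf C (- int 0) - backward_cf B (- int 0)\<bar> \<le> (1 / 4) ^ N"
  proof (rule chain_close[where c = "\<lambda>k. B (- int k)"])
    show "backward_cf C (- int k) = of_int (B (- int k)) + 1 / backward_cf C (- int (Suc k))"
      if "k \<le> 2 * N" for k
    proof -
      have "C (- int k) = B (- int k)" using CB that m l_ge_1 by (simp add: K_def)
      then show ?thesis unfolding neg_Suc using backward_cf_unfold[OF C1, of "- int k"] by simp
    qed
    show "backward_cf B (- int k) = of_int (B (- int k)) + 1 / backward_cf B (- int (Suc k))" for k
      unfolding neg_Suc by (rule backward_cf_unfold[OF B1])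
    show "backward_cf C (- int k) \<ge> 1" "backward_cf B (- int k) \<ge> 1" for k
      using backward_cf_gt_1[OF C1, of "- int k"] backward_cf_gt_1[OF B1, of "- int k"] by simp_all
  qed (use B1 in auto)
  moreover have "(1 / 4) ^ N < \<delta>" using N zero_less_power[of "1 / 4 :: real" N] by linarith
  moreover have "C 0 = B 0" using agree[of 0] m l_ge_1 by simp
  ultimately have "biinf_lambda B 0 < biinf_lambda C 0"
    using fw by (simp add: biinf_lambda_eq[OF B1] biinf_lambda_eq[OF C1])
  then show False using maximal[OF C1 P CF] by simp
qed

text \<open>Pigeonhole on \<open>state\<close>, the parity together with the \<open>l - 1\<close>
  preceding letters: it takes finitely many values, equal states force equal letters, and equal
  letters carry the equality of states one position further.\<close>

lemma right_periodic:
  obtains p n :: nat where "p > 0" "\<And>k. k \<ge> n \<Longrightarrow> B (int (k + p)) = B (int k)"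
proof -
  define state where "state = (\<lambda>m. (even m, window B (l - 1) (int m - int l + 1)))"
  have "window B (l - 1) t \<in> {w. set w \<subseteq> {1..A} \<and> length w = l - 1}" for t
    using letter_bounds[OF allI, OF window_B] by (auto simp: window_def)
  then have "state ` {l..} \<subseteq> UNIV \<times> {w. set w \<subseteq> {1..A} \<and> length w = l - 1}"
    by (auto simp: state_def)
  then have "finite (state ` {l..})"
    by (rule finite_subset) (simp add: finite_lists_length_eq)
  then have "\<not> inj_on state {l..}" using finite_imageD infinite_Ici by blast
  then obtain m p where m: "m \<ge> l" "p > 0" "state m = state (m + p)"
    unfolding inj_on_def by (metis atLeast_iff less_imp_add_positive linorder_neqE_nat)
  have letter: "B (int i) = B (int j)" if ij: "i \<ge> l" "j \<ge> l" "state i = state j" for i j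
  proof -
    have par: "even i \<longleftrightarrow> even j" and win: "\<And>k. k < l - 1 \<Longrightarrow> B (int i - int l + 1 + int k) = B (int j - int l + 1 + int k)"
      using ij(3) by (auto simp: state_def window_eq_iff)
    have branch: "window (B(int i := B (int j))) l (int i - int l + 1) = window B l (int j - int l + 1)"
      if "\<And>k. k < l - 1 \<Longrightarrow> B (int i - int l + 1 + int k) = B (int j - int l + 1 + int k)" for i j
      unfolding window_eq_iff
    proof (intro allI impI)
      fix k assume "k < l"
      then consider "k < l - 1" | "k = l - 1" by linarith
      then show "(B(int i := B (int j))) (int i - int l + 1 + int k) = B (int j - int l + 1 + int k)"
        using that \<open>k < l\<close> by cases (auto simp: of_nat_diff)
    qed
    \<comment> \<open>Equal contexts make each letter an admissible continuation at the other
      position; as the parities agree, the two inequalities are opposite.\<close>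
    have "(- 1) ^ i * (B (int j) - B (int i)) \<le> 0" "(- 1) ^ j * (B (int i) - B (int j)) \<le> 0"
      using forced_letter[OF ij(1), of "B (int j)"] forced_letter[OF ij(2), of "B (int i)"]
        branch[OF win] branch[of j i] win window_B by simp_all
    then show ?thesis using par by (cases "even i") simp_all
  qed
  have "state (m + k) = state (m + p + k)" for k
  proof (induction k)
    case (Suc k)
    have last: "B (int (m + k)) = B (int (m + p + k))" using m Suc by (intro letter) auto
    have "B (int (m + Suc k) - int l + 1 + int j) = B (int (m + p + Suc k) - int l + 1 + int j)"
      if "j < l - 1" for j
    proof (cases "Suc j < l - 1")
      case True
      then have "B (int (m + k) - int l + 1 + int (Suc j)) = B (int (m + p + k) - int l + 1 + int (Suc j))"
        using Suc unfolding state_def window_eq_iff prod.inject by blast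
      then show ?thesis by (simp add: algebra_simps)
    next
      case False
      then have "int (m + Suc k) - int l + 1 + int j = int (m + k)"
        "int (m + p + Suc k) - int l + 1 + int j = int (m + p + k)" using that by linarith+
      then show ?thesis using last by (simp only:)
    qed
    moreover have "even (m + Suc k) \<longleftrightarrow> even (m + p + Suc k)" using Suc by (simp add: state_def)
    ultimately show ?case unfolding state_def window_eq_iff prod.inject by blast
  qed (use m in simp)
  then have "B (int (m + k)) = B (int (m + p + k))" for k using m by (intro letter) auto
  then have "B (int (k + p)) = B (int k)" if "k \<ge> m" for k
    using that by (metis add.assoc add.commute le_add_diff_inverse)
  then show thesis using that m by blast
qed

text \<open>Paths are traversed backwards, and \<open>biinf_lambda\<close> at 0 is symmetric. This
  makes \<open>right_periodic\<close> available for the left half of \<open>B\<close>.\<close>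

lemma reverse: "block_system l (rev ` F) A (\<lambda>t. B (- t))"
proof
  show "l \<ge> 1" by (rule l_ge_1)
  show "set w \<subseteq> {1..A}" if "w \<in> rev ` F" for w using letters that by fastforce
  show "window (\<lambda>t. B (- t)) l t \<in> rev ` F" for t using window_B by (simp add: window_reverse)
next
  fix w v assume "w \<in> rev ` F" "v \<in> rev ` F"
  then have "rev w \<in> F" "rev v \<in> F" by auto
  from connected[OF this(2,1)] obtain s n where n: "n \<ge> l"
    and s: "window s l 0 = rev v" "window s l (int n) = rev w"
    and sF: "\<And>t. 0 \<le> t \<Longrightarrow> t \<le> int n \<Longrightarrow> window s l t \<in> F" by blast
  \<comment> \<open>\<open>n + l - 1\<close> is the last position of the path, so the reflection
    takes the block at \<open>t\<close> to the one at \<open>n - t\<close>.\<close>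
  define s' where "s' = (\<lambda>t. s (int n + int l - 1 - t))"
  have "window s' l t = rev (window (\<lambda>t. s (int n + int l - 1 + t)) l (1 - t - int l))" for t
    unfolding window_reverse[symmetric] s'_def by simp
  also have "window (\<lambda>t. s (int n + int l - 1 + t)) l (1 - t - int l) = window s l (int n - t)" for t
    by (simp add: window_eq_iff algebra_simps)
  finally have s': "window s' l t = rev (window s l (int n - t))" for t .
  show "\<exists>s n. n \<ge> l \<and> window s l 0 = w \<and> window s l (int n) = v \<and>
      (\<forall>t. 0 \<le> t \<and> t \<le> int n \<longrightarrow> window s l t \<in> rev ` F)"
    using n s sF by (intro exI[of _ s'] exI[of _ n]) (simp add: s')
next
  fix C :: "int \<Rightarrow> int" and P
  assume C: "\<forall>t. C t \<ge> 1" "P > 0" "\<forall>t. C (t + P) = C t" "\<forall>t. window C l t \<in> rev ` F"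
  have "biinf_lambda (\<lambda>t. C (- t)) 0 \<le> biinf_lambda B 0"
  proof (rule maximal[OF _ C(2)])
    show "\<forall>t. C (- (t + P)) = C (- t)"
      using C(3) by (metis diff_add_cancel minus_add_distrib uminus_add_conv_diff add.commute)
    show "\<forall>t. window (\<lambda>t. C (- t)) l t \<in> F"
      using C(4) by (auto simp: window_reverse) (metis imageE rev_rev_ident)
  qed (use C in simp)
  moreover have sym: "biinf_lambda (\<lambda>t. D (- t)) 0 = biinf_lambda D 0" if D: "\<forall>t. D t \<ge> 1" for D
    using biinf_lambda_eq[OF D, of 0] biinf_lambda_eq[of "\<lambda>t. D (- t)" 0] D
    by (simp add: backward_cf_eq)
  moreover have "\<forall>t. B t \<ge> 1" using letter_bounds[OF allI, OF window_B] by simp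
  ultimately show "biinf_lambda C 0 \<le> biinf_lambda (\<lambda>t. B (- t)) 0" using C(1) by simp
qed

end

section \<open>Blocks occurring infinitely often\<close>

lemma eventually_partial_quotient_bounded:
  assumes "\<alpha> \<notin> \<rat>" "lagrange_constant \<alpha> = ereal a" "a > 0"
  obtains k0 where "\<forall>k\<ge>k0. partial_quotient \<alpha> k \<in> {1..\<lfloor>a + 1\<rfloor>}"
proof -
  interpret cf_expansion "partial_quotient \<alpha>" "complete_quotient \<alpha>"
    by (rule cf_expansion_complete_quotient) fact
  obtain n0 where n0: "\<And>n. n \<ge> n0 \<Longrightarrow> lam n \<le> a + 1"
    using eventually_lam_le[OF assms, of 1] by (auto simp: eventually_sequentially)
  have "partial_quotient \<alpha> k \<in> {1..\<lfloor>a + 1\<rfloor>}" if k: "k \<ge> Suc n0" for k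
  proof -
    obtain n where n: "k = Suc n" using k by (cases k) auto
    have "of_int (partial_quotient \<alpha> k) \<le> complete_quotient \<alpha> k"
      by (simp add: partial_quotient_def)
    also have "\<dots> \<le> lam n" using den_nonneg by (simp add: lam_def n)
    also have "\<dots> \<le> a + 1" using k n by (intro n0) simp
    finally have "partial_quotient \<alpha> k \<le> \<lfloor>a + 1\<rfloor>" by (simp only: le_floor_iff)
    then show ?thesis using a_ge_1[of n] n by simp
  qed
  then show thesis using that by blast
qed

lemma length_quotient_block [simp]: "length (quotient_block \<alpha> l k) = l"
  by (simp add: quotient_block_def)

lemma quotient_block_nth [simp]: "j < l \<Longrightarrow> quotient_block \<alpha> l k ! j = partial_quotient \<alpha> (k + j)"
  by (simp add: quotient_block_def)

lemma recurrent_block_occurs: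
  assumes "w \<in> recurrent_blocks \<alpha> l"
  obtains k where "k \<ge> k0" "quotient_block \<alpha> l k = w"
  using assms unfolding recurrent_blocks_def infinite_nat_iff_unbounded_le by blast

text \<open>There are finitely many blocks over a finite alphabet, and each non-recurrent one occurs
  only finitely often.\<close>

lemma eventually_recurrent:
  assumes bnd: "\<forall>k\<ge>k0. partial_quotient \<alpha> k \<in> {1..A}"
  obtains k1 where "\<forall>k\<ge>k1. quotient_block \<alpha> l k \<in> recurrent_blocks \<alpha> l"
proof -
  let ?W = "{w. set w \<subseteq> {1..A} \<and> length w = l} - recurrent_blocks \<alpha> l"
  have "finite (\<Union>w\<in>?W. {k. k \<ge> 1 \<and> quotient_block \<alpha> l k = w})"
    by (intro finite_UN_I finite_Diff finite_lists_length_eq) (auto simp: recurrent_blocks_def)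
  then obtain k1 where k1: "\<forall>k\<in>(\<Union>w\<in>?W. {k. k \<ge> 1 \<and> quotient_block \<alpha> l k = w}). k \<le> k1"
    using finite_nat_set_iff_bounded_le by blast
  have "quotient_block \<alpha> l k \<in> recurrent_blocks \<alpha> l" if k: "k \<ge> k0 + k1 + 1" for k
  proof (rule ccontr)
    assume "quotient_block \<alpha> l k \<notin> recurrent_blocks \<alpha> l"
    moreover have "set (quotient_block \<alpha> l k) \<subseteq> {1..A}"
      using bnd k by (auto simp: quotient_block_def)
    ultimately have "quotient_block \<alpha> l k \<in> ?W" by simp
    then have "k \<le> k1" using k by (intro bspec[OF k1] UN_I) auto
    then show False using k by simp
  qed
  then show thesis using that by blast
qed

text \<open>The path is a stretch of the expansion of \<alpha>, from an occurrence of
  \<open>w\<close> beyond \<open>k1\<close> to an occurrence of \<open>v\<close> at least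
  \<open>l\<close> places later.\<close>

lemma recurrent_blocks_connected:
  assumes ev: "\<forall>k\<ge>k1. quotient_block \<alpha> l k \<in> recurrent_blocks \<alpha> l"
    and w: "w \<in> recurrent_blocks \<alpha> l" and v: "v \<in> recurrent_blocks \<alpha> l"
  shows "\<exists>s n. n \<ge> l \<and> window s l 0 = w \<and> window s l (int n) = v \<and>
    (\<forall>t. 0 \<le> t \<and> t \<le> int n \<longrightarrow> window s l t \<in> recurrent_blocks \<alpha> l)"
proof -
  obtain k where k: "k \<ge> k1" "quotient_block \<alpha> l k = w" using recurrent_block_occurs[OF w] .
  obtain k' where k': "k' \<ge> k + l" "quotient_block \<alpha> l k' = v" using recurrent_block_occurs[OF v] .
  \<comment> \<open>\<open>nat\<close> extends \<open>s\<close> by a constant to negative positions;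
    only windows at \<open>t \<ge> 0\<close> are inspected.\<close>
  define s where "s = (\<lambda>t. partial_quotient \<alpha> (k + nat t))"
  have s: "window s l (int n) = quotient_block \<alpha> l (k + n)" for n
    by (simp add: list_eq_iff_nth_eq s_def nat_add_distrib add.assoc)
  have "window s l t \<in> recurrent_blocks \<alpha> l" if "0 \<le> t" for t
    using s[of "nat t"] that ev k by simp
  moreover have "window s l (int (k' - k)) = v" using s[of "k' - k"] k' by simp
  ultimately show ?thesis using s[of 0] k k' by (intro exI[of _ s] exI[of _ "k' - k"]) auto
qed

text \<open>The window lies in a central block of radius \<open>i\<close>, at offset
  \<open>c\<close>, and recurs along with that block.\<close>

lemma weakly_associated_window:
  assumes "weakly_associated B \<alpha>"
  shows "window B l t \<in> recurrent_blocks \<alpha> l"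
proof -
  define i where "i = nat \<bar>t\<bar> + l"
  define c where "c = nat (t + int i)"
  have c: "int c = t + int i" "c + l \<le> Suc (2 * i)" by (auto simp: c_def i_def)
  let ?S = "{k. k \<ge> 1 \<and> (\<forall>j \<le> 2 * i. partial_quotient \<alpha> (k + j) = B (int j - int i))}"
  have "infinite ?S" using assms by (simp add: weakly_associated_def)
  then have "infinite ((\<lambda>k. k + c) ` ?S)" by (simp add: finite_image_iff)
  moreover have "(\<lambda>k. k + c) ` ?S \<subseteq> {k. k \<ge> 1 \<and> quotient_block \<alpha> l k = window B l t}"
  proof clarify
    fix k
    assume k: "k \<ge> 1" "\<forall>j \<le> 2 * i. partial_quotient \<alpha> (k + j) = B (int j - int i)"
    have "partial_quotient \<alpha> (k + c + j) = B (t + int j)" if "j < l" for j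
    proof -
      have "partial_quotient \<alpha> (k + (c + j)) = B (int (c + j) - int i)" using that k c by simp
      then show ?thesis using c by (simp add: add.assoc)
    qed
    then show "k + c \<ge> 1 \<and> quotient_block \<alpha> l (k + c) = window B l t"
      using k by (simp add: list_eq_iff_nth_eq)
  qed
  ultimately have "infinite {k. k \<ge> 1 \<and> quotient_block \<alpha> l k = window B l t}"
    by (rule infinite_super[rotated])
  then show ?thesis by (simp add: recurrent_blocks_def)
qed

text \<open>A letter at least 2 is already exceeded by its own \<open>biinf_lambda\<close>; for the
  constant sequence 1 the crude bound \<open>3 / 2\<close> on both tails gives
  \<open>3 / 2 + 3 / 2 - 1 = 2\<close>. The result supplies the condition \<open>M \<ge> 2\<close>
  of \<open>lagrange_constant_le\<close>.\<close>

lemma biinf_lambda_upper_bound_ge_2: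
  assumes B: "\<forall>t. B t \<ge> 1" and le: "\<And>i. biinf_lambda B i \<le> a"
  shows "a \<ge> 2"
proof (cases "\<exists>i. B i \<ge> 2")
  case True
  then obtain i where "B i \<ge> 2" by blast
  then have "real_of_int (B i) \<ge> 2" by simp
  moreover have "backward_cf B i > of_int (B i)"
    using backward_cf_unfold[OF B, of i] backward_cf_gt_1[OF B, of "i - 1"] by simp
  moreover have "forward_cf B i > of_int (B i)" by (rule forward_cf_bounds[OF B])
  ultimately show ?thesis using le[of i] biinf_lambda_eq[OF B, of i] by linarith
next
  case False
  then have "B t = 1" for t using B by (metis linorder_not_le order.antisym zle_add1_eq_le one_add_one)
  then have B1: "B = (\<lambda>_. 1)" by auto
  have "forward_cf B i \<le> 2" for i using forward_cf_bounds(2)[OF B, of i] by (simp add: B1)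
  then have "1 / forward_cf B 1 \<ge> 1 / 2"
    using forward_cf_gt_1[OF B, of 1] by (intro divide_left_mono) auto
  then have "forward_cf B 0 \<ge> 3 / 2" using forward_cf_unfold[OF B, of 0] by (simp add: B1)
  moreover have "backward_cf B 0 = forward_cf B 0" unfolding backward_cf_eq by (simp add: B1)
  ultimately show ?thesis using le[of 0] biinf_lambda_eq[OF B, of 0] by (simp add: B1)
qed

section \<open>From periodic tails to the decomposition\<close>

lemma periodic_mod:
  fixes B :: "int \<Rightarrow> int" and f :: "nat \<Rightarrow> int"
  assumes "\<And>k. B (f (k + p)) = B (f k)"
  shows "B (f (k mod p)) = B (f k)"
proof -
  have "B (f (r + q * p)) = B (f r)" for q r
  proof (induction q)
    case (Suc q)
    then show ?case using assms[of "r + q * p"] by (simp add: algebra_simps)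
  qed simp
  from this[of "k mod p" "k div p"] show ?thesis by simp
qed

text \<open>The left period is collected leftwards from \<open>- m\<close>, hence \<open>rev\<close>
  in \<open>Pl\<close>; the right one starts at \<open>n + 1\<close>, and \<open>R\<close> fills the
  positions \<open>1 - m\<close> to \<open>n\<close>.\<close>

lemma biinf_decomposition_of_periodic_tails:
  fixes B :: "int \<Rightarrow> int"
  assumes B: "\<And>t. B t > 0" and p: "p > 0" "\<forall>k\<ge>n. B (int (k + p)) = B (int k)"
    and q: "q > 0" "\<forall>k\<ge>m. B (- int (k + q)) = B (- int k)"
  shows "\<exists>Pl R Pr :: int list. Pl \<noteq> [] \<and> Pr \<noteq> [] \<and>
    (\<forall>x \<in> set Pl \<union> set R \<union> set Pr. x > 0) \<and> biinf_decomposition B Pl R Pr"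
proof -
  define Pl where "Pl = rev (map (\<lambda>k. B (- int (m + k))) [0..<q])"
  define R where "R = map (\<lambda>k. B (1 - int m + int k)) [0..<m + n]"
  define Pr where "Pr = map (\<lambda>k. B (int (n + 1 + k))) [0..<p]"
  have "B (- int (m + k mod q)) = B (- int (m + k))" for k
    using q(2) by (intro periodic_mod) (metis add.assoc le_add1)
  then have left: "B (1 - int m - 1 - int k) = rev Pl ! (k mod length Pl)" for k
    using q by (simp add: Pl_def)
  have "B (int (n + 1 + k mod p)) = B (int (n + 1 + k))" for k
    using p(2) by (intro periodic_mod) (metis add.assoc le_add1)
  then have right: "B (1 - int m + int (length R) + int k) = Pr ! (k mod length Pr)" for k
    using p by (simp add: Pr_def R_def algebra_simps)
  have "biinf_decomposition B Pl R Pr"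
    unfolding biinf_decomposition_def
    by (intro exI[of _ "1 - int m"] conjI allI impI left right) (simp add: R_def)
  moreover have "Pl \<noteq> []" "Pr \<noteq> []" using p q by (simp_all add: Pl_def Pr_def)
  moreover have "\<forall>x \<in> set Pl \<union> set R \<union> set Pr. x > 0" using B by (auto simp: Pl_def R_def Pr_def)
  ultimately show ?thesis by blast
qed

theorem theorem1:
  fixes a b \<alpha> :: real and B :: "int \<Rightarrow> int"
  assumes "maximal_gap a b"
    and "\<alpha> \<notin> \<rat>"
    and "lagrange_constant \<alpha> = ereal a"
    and "\<And>i. B i > 0"
    and "strongly_associated B \<alpha>"
  shows "\<exists>Pl R Pr :: int list. Pl \<noteq> [] \<and> Pr \<noteq> [] \<and>
           (\<forall>x \<in> set Pl \<union> set R \<union> set Pr. x > 0) \<and>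
           biinf_decomposition B Pl R Pr"
proof -
  have a: "biinf_lambda B 0 = a" and sup: "ereal a = biinf_sup B" and weak: "weakly_associated B \<alpha>"
    using assms(3,5) by (simp_all add: strongly_associated_def)
  have B1: "\<forall>t. B t \<ge> 1" using assms(4) by (simp add: int_one_le_iff_zero_less)
  have "ereal (biinf_lambda B i) \<le> ereal a" for i
    unfolding sup biinf_sup_def by (rule SUP_upper) simp
  then have a2: "a \<ge> 2" using biinf_lambda_upper_bound_ge_2[OF B1] by simp
  obtain l where l: "l \<ge> 1" and gap: "\<And>C P. \<lbrakk>\<forall>t. C t \<ge> 1; P > 0; \<forall>t. C (t + P) = C t;
      \<forall>t. window C l t \<in> recurrent_blocks \<alpha> l\<rbrakk> \<Longrightarrow> biinf_lambda C 0 \<le> a"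
    using periodic_lambda_le_gap[OF assms(1-3) a2] by blast
  obtain k0 where k0: "\<forall>k\<ge>k0. partial_quotient \<alpha> k \<in> {1..\<lfloor>a + 1\<rfloor>}"
    using eventually_partial_quotient_bounded[OF assms(2,3)] a2 by auto
  obtain k1 where k1: "\<forall>k\<ge>k1. quotient_block \<alpha> l k \<in> recurrent_blocks \<alpha> l"
    using eventually_recurrent[OF k0] .
  interpret block_system l "recurrent_blocks \<alpha> l" "\<lfloor>a + 1\<rfloor>" B
  proof
    show "set w \<subseteq> {1..\<lfloor>a + 1\<rfloor>}" if w: "w \<in> recurrent_blocks \<alpha> l" for w
    proof -
      obtain k where "k \<ge> k0" "quotient_block \<alpha> l k = w" using recurrent_block_occurs[OF w] .
      then show ?thesis using k0 by (auto simp: quotient_block_def simp del: atLeastAtMost_iff)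
    qed
  qed (use l gap a in \<open>auto intro: recurrent_blocks_connected[OF k1] weakly_associated_window[OF weak]\<close>)
  \<comment> \<open>Right periodicity of the reversed sequence is left periodicity of
    \<open>B\<close>.\<close>
  interpret rev: block_system l "rev ` recurrent_blocks \<alpha> l" "\<lfloor>a + 1\<rfloor>" "\<lambda>t. B (- t)"
    by (rule reverse)
  obtain p n where p: "p > 0" "\<forall>k\<ge>n. B (int (k + p)) = B (int k)"
    using right_periodic by blast
  obtain q m where q: "q > 0" "\<forall>k\<ge>m. B (- int (k + q)) = B (- int k)"
    using rev.right_periodic by blast
  show ?thesis
    using biinf_decomposition_of_periodic_tails[OF assms(4) p q] .
qed

end
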